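(* Let $(X,\leq,\wedge)$ be an $\omega_1$-like lower semi-lattice. Then there is a $*$-lower semi-lattice $\mathcal{T}\subseteq\mathscr{P}(\omega)$ such that $(\mathcal{T},\subseteq^* )$ is order-isomorphic to $(X,\leq)$ and $|G(\mathcal{T})|=2^{\omega_1}$.
   Context: $A\subseteq^*B$ means $A\setminus B$ is finite; $A=^*B$ means $A\subseteq^*B$ and $B\subseteq^*A$. A lower semi-lattice is a partial order in which every two elements $x,y$ have an infimum $x\wedge y$. It is $\omega_1$-like if it is well-founded, of size $\omega_1$, and $\{y:y<x\}$ is countable for each $x$. A family $\mathcal{T}\subseteq\mathscr{P}(\omega)$ is a $*$-lower semi-lattice if for any $A,B\in\mathcal{T}$ there is $C\in\mathcal{T}$ with $A\cap B=^*C$. A coherent subsystem of $\mathcal{T}$ is a function $g:\mathcal{T}\to\mathscr{P}(\omega)$ with $g(A)\subseteq A$ for all $A$, and $g(A)\cap B=^*g(B)$ whenever $B\subseteq^*A$; it is trivial if some $C\subseteq\omega$ satisfies $C\cap A=^*g(A)$ for all $A\in\mathcal{T}$. $C(\mathcal{T})$ is the set of coherent subsystems, a group under $(f\cdot g)(A)=f(A)\triangle g(A)$, and $Tr(\mathcal{T})$ its subgroup of trivial ones; the gap cohomology group is $G(\mathcal{T})=C(\mathcal{T})/Tr(\mathcal{T})$. *)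

theory Defs
  imports "HOL-Library.Countable_Set"
begin

definition subset_star :: "nat set \<Rightarrow> nat set \<Rightarrow> bool" where
  "subset_star A B \<longleftrightarrow> finite (A - B)"

definition eq_star :: "nat set \<Rightarrow> nat set \<Rightarrow> bool" where
  "eq_star A B \<longleftrightarrow> subset_star A B \<and> subset_star B A"

definition partial_order_on_set :: "'a set \<Rightarrow> ('a \<Rightarrow> 'a \<Rightarrow> bool) \<Rightarrow> bool" where
  "partial_order_on_set X le \<longleftrightarrow>
     (\<forall>x\<in>X. le x x) \<and>
     (\<forall>x\<in>X. \<forall>y\<in>X. le x y \<and> le y x \<longrightarrow> x = y) \<and>
     (\<forall>x\<in>X. \<forall>y\<in>X. \<forall>z\<in>X. le x y \<and> le y z \<longrightarrow> le x z)"

definition is_inf :: "'a set \<Rightarrow> ('a \<Rightarrow> 'a \<Rightarrow> bool) \<Rightarrow> 'a \<Rightarrow> 'a \<Rightarrow> 'a \<Rightarrow> bool" where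
  "is_inf X le x y z \<longleftrightarrow> z \<in> X \<and> le z x \<and> le z y \<and>
     (\<forall>w\<in>X. le w x \<and> le w y \<longrightarrow> le w z)"

definition lower_semi_lattice :: "'a set \<Rightarrow> ('a \<Rightarrow> 'a \<Rightarrow> bool) \<Rightarrow> bool" where
  "lower_semi_lattice X le \<longleftrightarrow> partial_order_on_set X le \<and>
     (\<forall>x\<in>X. \<forall>y\<in>X. \<exists>z. is_inf X le x y z)"

definition omega1_like :: "'a set \<Rightarrow> ('a \<Rightarrow> 'a \<Rightarrow> bool) \<Rightarrow> bool" where
  "omega1_like X le \<longleftrightarrow>
     wfP (\<lambda>a b. a \<in> X \<and> b \<in> X \<and> le a b \<and> a \<noteq> b) \<and>
     (card_of X, cardSuc natLeq) \<in> ordIso \<and>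
     (\<forall>x\<in>X. countable {y \<in> X. le y x \<and> y \<noteq> x})"

definition star_lower_semi_lattice :: "nat set set \<Rightarrow> bool" where
  "star_lower_semi_lattice T \<longleftrightarrow>
     (\<forall>A\<in>T. \<forall>B\<in>T. \<exists>C\<in>T. eq_star (A \<inter> B) C)"

text \<open>Coherent subsystems g : T \<rightarrow> P(omega); represented as total functions
  that are {} outside T (so that each function on T has a unique representative).\<close>
definition coherent_subsystems :: "nat set set \<Rightarrow> (nat set \<Rightarrow> nat set) set" where
  "coherent_subsystems T = {g.
     (\<forall>A. A \<notin> T \<longrightarrow> g A = {}) \<and>
     (\<forall>A\<in>T. g A \<subseteq> A) \<and>
     (\<forall>A\<in>T. \<forall>B\<in>T. subset_star B A \<longrightarrow> eq_star (g A \<inter> B) (g B))}"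

definition trivial_subsystem :: "nat set set \<Rightarrow> (nat set \<Rightarrow> nat set) \<Rightarrow> bool" where
  "trivial_subsystem T g \<longleftrightarrow> (\<exists>C. \<forall>A\<in>T. eq_star (C \<inter> A) (g A))"

definition sym_diff :: "nat set \<Rightarrow> nat set \<Rightarrow> nat set" where
  "sym_diff A B = (A - B) \<union> (B - A)"

definition trivial_subsystems :: "nat set set \<Rightarrow> (nat set \<Rightarrow> nat set) set" where
  "trivial_subsystems T = {g \<in> coherent_subsystems T. trivial_subsystem T g}"

text \<open>The gap cohomology group C(T)/Tr(T) as the set of cosets of Tr(T)
  in C(T) w.r.t. the pointwise symmetric difference operation.\<close>
definition gap_cohomology :: "nat set set \<Rightarrow> (nat set \<Rightarrow> nat set) set set" where
  "gap_cohomology T = coherent_subsystems T //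
     {(f, g). f \<in> coherent_subsystems T \<and> g \<in> coherent_subsystems T \<and>
              (\<lambda>A. sym_diff (f A) (g A)) \<in> trivial_subsystems T}"

end

theory Submission
  imports Defs "HOL-Library.Nat_Bijection"
begin

text \<open>
  Index everything by \<open>X\<close>. A transfinite recursion of length \<open>\<omega>\<^sub>1\<close> represents \<open>X\<close> by sets \<open>B x\<close>
  which contain infinite sets \<open>D x\<close> almost disjoint from every \<open>B z\<close> with \<open>x \<not>\<le> z\<close>. Over a countable
  initial segment every coherent system is trivial, hence extends; as its values on \<open>D x\<close> are free,
  there are \<open>2\<close> to the \<open>\<omega>\<^sub>1\<close> coherent systems which differ modulo finite. Each class modulo trivial
  systems contains at most continuum many of them, so it remains to find continuum many distinct
  classes.

  A single nontrivial system is enough for that: pull everything back along the finite-to-one map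
  \<open>(n, k) \<mapsto> k\<close> on \<open>{(n, k). n \<le> k}\<close> and restrict the pulled back system to the rows \<open>n \<in> \<psi>\<close>, for
  arbitrary \<open>\<psi> \<subseteq> \<omega>\<close>.

  For a nontrivial system there are two cases. If some uncountable \<open>Y \<subseteq> X\<close> has only finitely many
  elements below each \<open>x\<close>, add to \<open>B x\<close> (on a disjoint copy of \<open>\<omega>\<close>) the finite union of the
  members \<open>L y\<close>, \<open>y \<in> Y\<close>, \<open>y \<le> x\<close>, of a Luzin family. Otherwise every uncountable subset of \<open>X\<close> has
  infinitely many elements below a single \<open>x\<close>, and a Hausdorff-type condition on pairs \<open>u < x\<close>
  suffices to prevent triviality.
\<close>

section \<open>Preliminaries\<close>

unbundle cardinal_syntax

section \<open>Countability, and relations modulo finite as statements about the cofinite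
  filter\<close>

lemma countable_iff_card_of_le_natLeq: "countable A \<longleftrightarrow> |A| \<le>o natLeq"
proof -
  have "countable A \<longleftrightarrow> |A| \<le>o |UNIV :: nat set|"
    by (simp add: countable_def flip: card_of_ordLeq)
  then show ?thesis
    using card_of_nat ordLeq_ordIso_trans ordIso_symmetric by blast
qed

lemma uncountable_of_card_of_cardSuc:
  assumes "|X| =o cardSuc natLeq"
  shows "uncountable X"
proof
  assume "countable X"
  then have "|X| \<le>o natLeq" by (simp add: countable_iff_card_of_le_natLeq)
  then have "|X| <o cardSuc natLeq"
    using cardSuc_ordLeq_ordLess[OF natLeq_Card_order card_of_Card_order] by blast
  then show False using assms not_ordLess_ordIso by blast
qed

lemma eventually_cofinite_not_mem: "(\<forall>\<^sub>\<infinity>p. p \<notin> A) \<longleftrightarrow> finite A"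
  by (simp add: eventually_cofinite)

lemma eventually_cofinite_inj:
  assumes "inj f" "\<forall>\<^sub>\<infinity>q. P q"
  shows "\<forall>\<^sub>\<infinity>p. P (f p)"
  using finite_vimageI[OF _ assms(1), of "{q. \<not> P q}"] assms(2)
  by (simp add: eventually_cofinite vimage_def)

lemma eventually_cofinite_nat_bound:
  fixes P :: "nat \<Rightarrow> bool"
  assumes "\<forall>\<^sub>\<infinity>p. P p"
  shows "\<exists>n. \<forall>p\<ge>n. P p"
  using assms by (simp add: cofinite_eq_sequentially eventually_sequentially)

lemma infinite_cofinite_ex:
  assumes "infinite A" "\<forall>\<^sub>\<infinity>p. p \<in> A \<longrightarrow> P p"
  shows "\<exists>p. p \<in> A \<and> P p"
proof (rule ccontr)
  assume "\<not> ?thesis"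
  then have "A \<subseteq> {p. \<not> (p \<in> A \<longrightarrow> P p)}" by blast
  then show False using assms finite_subset by (auto simp: eventually_cofinite)
qed

lemma finite_to_nat_on_le:
  assumes "countable A"
  shows "finite {a \<in> A. to_nat_on A a \<le> n}"
proof (rule finite_imageD)
  show "finite (to_nat_on A ` {a \<in> A. to_nat_on A a \<le> n})"
    by (rule finite_subset[of _ "{..n}"]) auto
  show "inj_on (to_nat_on A) {a \<in> A. to_nat_on A a \<le> n}"
    by (rule inj_on_subset[OF inj_on_to_nat_on[OF assms]]) auto
qed

lemma subset_star_iff: "subset_star A B \<longleftrightarrow> (\<forall>\<^sub>\<infinity>p. p \<in> A \<longrightarrow> p \<in> B)"
  by (simp add: subset_star_def eventually_cofinite set_diff_eq)

lemma eq_star_iff: "eq_star A B \<longleftrightarrow> (\<forall>\<^sub>\<infinity>p. p \<in> A \<longleftrightarrow> p \<in> B)"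
proof -
  have "(\<forall>\<^sub>\<infinity>p. p \<in> A \<longleftrightarrow> p \<in> B) \<longleftrightarrow> (\<forall>\<^sub>\<infinity>p. (p \<in> A \<longrightarrow> p \<in> B) \<and> (p \<in> B \<longrightarrow> p \<in> A))"
    by (rule eventually_cong[OF always_eventually]) auto
  then show ?thesis
    by (simp add: eq_star_def subset_star_iff eventually_conj_iff)
qed

section \<open>Columns of the natural numbers and almost disjoint transversals\<close>

definition column :: "nat \<Rightarrow> nat" where
  "column p = fst (prod_decode p)"

lemma infinite_column: "infinite {p. column p = n}"
proof
  assume "finite {p. column p = n}"
  then have "finite (range (\<lambda>k. prod_encode (n, k)))"
    by (rule finite_subset[rotated]) (auto simp: column_def)
  moreover have "inj (\<lambda>k. prod_encode (n, k))" by (auto intro: injI)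
  ultimately show False using finite_imageD by blast
qed

lemma column_le: "column p \<le> p"
  using le_prod_encode_1[of "fst (prod_decode p)" "snd (prod_decode p)"]
  by (simp add: column_def)

text \<open>Diagonalisation: the point chosen in column \<open>n\<close> avoids the finitely many
  \<open>f z\<close> of index at most \<open>n\<close>, each of which meets that column in a finite
  set. With one point per column, \<open>D\<close> is itself finite on initial columns, so sets
  built from it can take part in later stages of a recursion.\<close>

lemma almost_disjoint_transversal:
  assumes A: "countable A" and fin: "\<And>z n. z \<in> A \<Longrightarrow> finite {p \<in> f z. column p \<le> n}"
  obtains D where "infinite D" "\<And>n. finite {p \<in> D. column p \<le> n}"
    "\<And>z. z \<in> A \<Longrightarrow> finite (D \<inter> f z)"
proof -
  have "\<exists>p. column p = n \<and> (\<forall>z\<in>A. to_nat_on A z \<le> n \<longrightarrow> p \<notin> f z)" for n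
  proof -
    have "finite (\<Union>z\<in>{z \<in> A. to_nat_on A z \<le> n}. {p \<in> f z. column p \<le> n})" (is "finite ?U")
      using fin finite_to_nat_on_le[OF A] by auto
    then obtain p where "column p = n" "p \<notin> ?U"
      using infinite_column[of n] finite_subset[of "{p. column p = n}" ?U] by blast
    then show ?thesis by auto
  qed
  then obtain q where q: "\<And>n. column (q n) = n"
    "\<And>n z. z \<in> A \<Longrightarrow> to_nat_on A z \<le> n \<Longrightarrow> q n \<notin> f z" by metis
  have "inj q" by (metis injI q(1))
  show thesis
  proof
    show "infinite (range q)" using \<open>inj q\<close> finite_imageD by blast
    show "finite {p \<in> range q. column p \<le> n}" for n
      by (rule finite_subset[of _ "q ` {..n}"]) (auto simp: q(1))
    show "finite (range q \<inter> f z)" if "z \<in> A" for z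
    proof (rule finite_subset[of _ "q ` {..<to_nat_on A z}"])
      show "range q \<inter> f z \<subseteq> q ` {..<to_nat_on A z}" using q(2)[OF that] not_le by blast
    qed simp
  qed
qed

lemma uncountable_pigeonhole:
  assumes "uncountable Y" "\<And>y. y \<in> Y \<Longrightarrow> \<exists>n::nat. Q y n"
  obtains n where "uncountable {y \<in> Y. Q y n}"
proof -
  have "\<exists>n. uncountable {y \<in> Y. Q y n}"
  proof (rule ccontr)
    assume "\<not> ?thesis"
    then have "countable (\<Union>n. {y \<in> Y. Q y n})" by simp
    moreover have "Y = (\<Union>n. {y \<in> Y. Q y n})" using assms(2) by auto
    ultimately show False using assms(1) by simp
  qed
  then show thesis using that by blast
qed

lemma eventually_cofinite_div2:
  fixes P :: "nat \<Rightarrow> bool"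
  assumes "\<forall>\<^sub>\<infinity>p. P p"
  shows "\<forall>\<^sub>\<infinity>q. P (q div 2)"
proof -
  have fin: "finite {p. \<not> P p}" using assms by (simp add: eventually_cofinite)
  have "{q. \<not> P (q div 2)} \<subseteq> (\<lambda>p. 2 * p) ` {p. \<not> P p} \<union> (\<lambda>p. 2 * p + 1) ` {p. \<not> P p}"
  proof
    fix q assume "q \<in> {q. \<not> P (q div 2)}"
    moreover have "q = 2 * (q div 2) \<or> q = 2 * (q div 2) + 1" by presburger
    ultimately show "q \<in> (\<lambda>p. 2 * p) ` {p. \<not> P p} \<union> (\<lambda>p. 2 * p + 1) ` {p. \<not> P p}" by blast
  qed
  then show ?thesis unfolding eventually_cofinite
    by (rule finite_subset) (use fin in simp)
qed

text \<open>The preimage of \<open>S\<close> under the second projection, restricted to pairs whose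
  first coordinate is at most the second. The restriction makes the fibres finite, so relations
  modulo finite survive, while row \<open>n\<close> loses only the points with
  \<open>k < n\<close>.\<close>

definition pullback :: "nat set \<Rightarrow> nat set" where
  "pullback S = {q. fst (prod_decode q) \<le> snd (prod_decode q) \<and> snd (prod_decode q) \<in> S}"

lemma eventually_cofinite_pullback:
  assumes "\<forall>\<^sub>\<infinity>p. P p"
  shows "\<forall>\<^sub>\<infinity>q. fst (prod_decode q) \<le> snd (prod_decode q) \<longrightarrow> P (snd (prod_decode q))"
proof -
  have fin: "finite {p. \<not> P p}" using assms by (simp add: eventually_cofinite)
  have "{q. \<not> (fst (prod_decode q) \<le> snd (prod_decode q) \<longrightarrow> P (snd (prod_decode q)))}
      \<subseteq> prod_encode ` (\<Union>k\<in>{p. \<not> P p}. {..k} \<times> {k})"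
  proof
    fix q assume q: "q \<in> {q. \<not> (fst (prod_decode q) \<le> snd (prod_decode q) \<longrightarrow> P (snd (prod_decode q)))}"
    show "q \<in> prod_encode ` (\<Union>k\<in>{p. \<not> P p}. {..k} \<times> {k})"
      by (rule image_eqI[of _ _ "prod_decode q"])
        (use q in \<open>auto simp: mem_Times_iff intro!: exI[of _ "snd (prod_decode q)"]\<close>)
  qed
  then show ?thesis unfolding eventually_cofinite
    by (rule finite_subset) (use fin in auto)
qed

lemma infinite_pullback:
  assumes "infinite S"
  shows "infinite (pullback S)"
proof
  assume "finite (pullback S)"
  then have "finite ((\<lambda>k. prod_encode (0, k)) ` S)"
    by (rule finite_subset[rotated]) (auto simp: pullback_def)
  moreover have "inj_on (\<lambda>k. prod_encode (0, k)) S" by (auto intro: inj_onI)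
  ultimately show False using assms finite_imageD by blast
qed

section \<open>The cohomology relation\<close>

definition cohomologous :: "nat set set \<Rightarrow> ((nat set \<Rightarrow> nat set) \<times> (nat set \<Rightarrow> nat set)) set" where
  "cohomologous T = {(f, g). f \<in> coherent_subsystems T \<and> g \<in> coherent_subsystems T \<and>
     (\<lambda>A. sym_diff (f A) (g A)) \<in> trivial_subsystems T}"

lemma gap_cohomology_quotient: "gap_cohomology T = coherent_subsystems T // cohomologous T"
  by (simp add: gap_cohomology_def cohomologous_def)

lemma mem_sym_diff: "p \<in> sym_diff A B \<longleftrightarrow> (p \<in> A \<longleftrightarrow> p \<notin> B)"
  by (auto simp: sym_diff_def)

lemma sym_diff_coherent_subsystems:
  assumes f: "f \<in> coherent_subsystems T" and g: "g \<in> coherent_subsystems T"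
  shows "(\<lambda>A. sym_diff (f A) (g A)) \<in> coherent_subsystems T"
  unfolding coherent_subsystems_def mem_Collect_eq
proof (intro conjI allI ballI impI)
  fix A B assume AB: "A \<in> T" "B \<in> T" "subset_star B A"
  have "\<forall>\<^sub>\<infinity>p. p \<in> f A \<inter> B \<longleftrightarrow> p \<in> f B" "\<forall>\<^sub>\<infinity>p. p \<in> g A \<inter> B \<longleftrightarrow> p \<in> g B"
    using f g AB by (auto simp: coherent_subsystems_def eq_star_iff)
  then show "eq_star (sym_diff (f A) (g A) \<inter> B) (sym_diff (f B) (g B))"
    unfolding eq_star_iff
  proof eventually_elim
    case (elim p)
    moreover have "f B \<subseteq> B" "g B \<subseteq> B" using f g AB by (auto simp: coherent_subsystems_def)
    ultimately show ?case unfolding Int_iff mem_sym_diff by blast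
  qed
qed (use f g in \<open>auto simp: coherent_subsystems_def sym_diff_def\<close>)

text \<open>The difference of two coherent subsystems is automatically coherent, so only the
  existence of a trivialising set \<open>C\<close> remains to be tested.\<close>

lemma cohomologous_iff:
  "(f, g) \<in> cohomologous T \<longleftrightarrow> f \<in> coherent_subsystems T \<and> g \<in> coherent_subsystems T \<and>
     (\<exists>C. \<forall>A\<in>T. \<forall>\<^sub>\<infinity>p. p \<in> C \<inter> A \<longleftrightarrow> (p \<in> f A \<longleftrightarrow> p \<notin> g A))"
  by (simp add: cohomologous_def trivial_subsystems_def trivial_subsystem_def eq_star_iff
      mem_sym_diff sym_diff_coherent_subsystems cong: conj_cong)

lemma equiv_cohomologous: "equiv (coherent_subsystems T) (cohomologous T)"
proof (rule equivI)
  show "cohomologous T \<subseteq> coherent_subsystems T \<times> coherent_subsystems T"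
    by (auto simp: cohomologous_def)
  show "refl_on (coherent_subsystems T) (cohomologous T)"
    by (auto simp: refl_on_def cohomologous_iff intro!: exI[of _ "{}"])
  show "sym (cohomologous T)"
  proof (rule symI)
    fix f g assume fg: "(f, g) \<in> cohomologous T"
    have "(p \<in> f A \<longleftrightarrow> p \<notin> g A) \<longleftrightarrow> (p \<in> g A \<longleftrightarrow> p \<notin> f A)" for p A by blast
    then show "(g, f) \<in> cohomologous T" using fg by (simp add: cohomologous_iff)
  qed
  \<comment> \<open>Trivialising sets for two successive differences combine by symmetric
    difference.\<close>
  show "trans (cohomologous T)"
  proof (rule transI)
    fix f g h assume fg: "(f, g) \<in> cohomologous T" and gh: "(g, h) \<in> cohomologous T"
    obtain C where C: "\<forall>A\<in>T. \<forall>\<^sub>\<infinity>p. p \<in> C \<inter> A \<longleftrightarrow> (p \<in> f A \<longleftrightarrow> p \<notin> g A)"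
      using fg unfolding cohomologous_iff by blast
    obtain C' where C': "\<forall>A\<in>T. \<forall>\<^sub>\<infinity>p. p \<in> C' \<inter> A \<longleftrightarrow> (p \<in> g A \<longleftrightarrow> p \<notin> h A)"
      using gh unfolding cohomologous_iff by blast
    have "\<forall>\<^sub>\<infinity>p. p \<in> sym_diff C C' \<inter> A \<longleftrightarrow> (p \<in> f A \<longleftrightarrow> p \<notin> h A)" if "A \<in> T" for A
      using C[rule_format, OF that] C'[rule_format, OF that]
      by eventually_elim (auto simp: mem_sym_diff)
    then show "(f, h) \<in> cohomologous T" using fg gh unfolding cohomologous_iff by blast
  qed
qed

text \<open>A subsystem is coded by its graph, a subset of \<open>T \<times> UNIV\<close>, and this
  product injects into \<open>T\<close>. The default value \<open>{}\<close> outside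
  \<open>T\<close> makes the graph determine the whole function.\<close>

lemma card_of_coherent_subsystems_le:
  assumes inf: "infinite T"
  shows "|coherent_subsystems T| \<le>o |Pow T|"
proof -
  have "|UNIV :: nat set| \<le>o |T|" using inf infinite_iff_card_of_nat by blast
  then have "|T \<times> (UNIV :: nat set)| \<le>o |T|"
    using card_of_Times_infinite_simps(1)[OF inf, of "UNIV :: nat set"] ordIso_imp_ordLeq by blast
  then obtain j where j: "inj_on j (T \<times> (UNIV :: nat set))" "j ` (T \<times> UNIV) \<subseteq> T"
    by (auto simp flip: card_of_ordLeq)
  define code where "code g = j ` (SIGMA A:T. g A)" for g :: "nat set \<Rightarrow> nat set"
  have "inj_on code (coherent_subsystems T)"
  proof (rule inj_onI)
    fix f g assume fg: "f \<in> coherent_subsystems T" "g \<in> coherent_subsystems T" "code f = code g"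
    have "(SIGMA A:T. f A) = (SIGMA A:T. g A)"
      using fg(3) inj_on_image_eq_iff[OF j(1), of "SIGMA A:T. f A" "SIGMA A:T. g A"]
      unfolding code_def by auto
    then have "f A = g A" if "A \<in> T" for A using that by auto
    moreover have "f A = g A" if "A \<notin> T" for A
      using fg(1,2) that by (simp add: coherent_subsystems_def)
    ultimately show "f = g" by blast
  qed
  moreover have "code g \<in> Pow T" for g using j(2) by (auto simp: code_def)
  ultimately show ?thesis by (rule card_of_ordLeqI)
qed

section \<open>Semilattices of type \<open>\<omega>\<^sub>1\<close>\<close>

text \<open>The rank \<open>\<rho>\<close> takes values in a well-order of type \<open>\<omega>\<^sub>1\<close> on \<open>X\<close> itself; requiring
  \<open>x \<le> \<rho> x\<close> there keeps its fibres countable, so that the lexicographic order on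
  \<open>(\<rho> x, x)\<close> still has countable initial segments.\<close>
lemma omega1_linear_extension:
  fixes X :: "'a set" and le :: "'a \<Rightarrow> 'a \<Rightarrow> bool"
  assumes wf: "wf {(a, b). a \<in> X \<and> b \<in> X \<and> le a b \<and> a \<noteq> b}"
    and card: "|X| =o cardSuc natLeq"
    and count: "\<And>x. x \<in> X \<Longrightarrow> countable {y \<in> X. le y x \<and> y \<noteq> x}"
  obtains R where "wf R" and "R \<subseteq> X \<times> X"
    and "\<forall>x\<in>X. \<forall>y\<in>X. x \<noteq> y \<longrightarrow> (x, y) \<in> R \<or> (y, x) \<in> R"
    and "\<forall>x. countable {y. (y, x) \<in> R}"
    and "\<forall>x\<in>X. \<forall>y\<in>X. le x y \<and> x \<noteq> y \<longrightarrow> (x, y) \<in> R"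
proof -
  define w where "w = |X|"
  have wo: "well_order_on X w" and F: "Field w = X"
    by (simp_all add: w_def card_of_well_order_on Field_card_of)
  have lin: "refl_on X w" "antisym w" "trans w" "total_on X w" and wfw: "wf (w - Id)"
    using wo by (auto simp: well_order_on_def linear_order_on_def partial_order_on_def
        preorder_on_def)
  have wX: "w \<subseteq> X \<times> X" using F by (auto simp: Field_def)
  have unc: "uncountable X" by (rule uncountable_of_card_of_cardSuc[OF card])
  \<comment> \<open>\<open>w\<close> is the cardinal well-order of a set of size
    \<open>omega_1\<close>, so its proper initial segments have smaller cardinality.\<close>
  have seg: "countable {y. (y, x) \<in> w}" for x
  proof (cases "x \<in> X")
    case True
    then have "|underS w x| <o w"
      unfolding w_def using card_of_underS[OF card_of_Card_order] by (simp add: Field_card_of)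
    then have "|underS w x| <o cardSuc natLeq"
      using card ordLess_ordIso_trans unfolding w_def by blast
    then have "countable (underS w x)"
      unfolding countable_iff_card_of_le_natLeq
      using cardSuc_ordLeq_ordLess[OF natLeq_Card_order card_of_Card_order] by blast
    then have "countable (insert x (underS w x))" by simp
    then show ?thesis by (rule countable_subset[rotated]) (auto simp: underS_def)
  next
    case False
    then show ?thesis using wX by (auto intro: countable_subset[of _ "{}"])
  qed
  \<comment> \<open>Countably many countable segments cannot cover \<open>X\<close>. This leaves the
    rank recursion a value beyond the countably many ones already used below
    \<open>x\<close>.\<close>
  have bound: "\<exists>z\<in>X. \<forall>k\<in>K. (k, z) \<in> w \<and> k \<noteq> z" if "countable K" "K \<subseteq> X" for K
  proof -
    have "countable (\<Union>k\<in>K. {y. (y, k) \<in> w})" using that(1) seg by simp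
    then obtain z where z: "z \<in> X" "z \<notin> (\<Union>k\<in>K. {y. (y, k) \<in> w})"
      using unc countable_subset[of X] by (metis subsetI)
    have "(k, z) \<in> w \<and> k \<noteq> z" if "k \<in> K" for k
    proof -
      have "k \<in> X" "(z, k) \<notin> w" using z that \<open>K \<subseteq> X\<close> by auto
      moreover have "k \<noteq> z" using \<open>(z, k) \<notin> w\<close> z(1) lin(1) by (auto simp: refl_on_def)
      ultimately show ?thesis using z(1) lin(4) by (auto simp: total_on_def)
    qed
    then show ?thesis using z(1) by blast
  qed
  have "\<exists>\<rho>. \<forall>x. x \<in> X \<longrightarrow> \<rho> x \<in> X \<and> (x, \<rho> x) \<in> w \<and>
      (\<forall>y. y \<in> X \<and> le y x \<and> y \<noteq> x \<longrightarrow> (\<rho> y, \<rho> x) \<in> w \<and> \<rho> y \<noteq> \<rho> x)"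
  proof (rule dependent_wf_choice[OF wf, where
        P = "\<lambda>\<rho> x v. x \<in> X \<longrightarrow> v \<in> X \<and> (x, v) \<in> w \<and>
          (\<forall>y. y \<in> X \<and> le y x \<and> y \<noteq> x \<longrightarrow> (\<rho> y, v) \<in> w \<and> \<rho> y \<noteq> v)"], goal_cases)
    case (1 f g x r)
    then show ?case by auto
  next
    case (2 x f)
    show ?case
    proof (cases "x \<in> X")
      case True
      let ?K = "insert x (f ` {y \<in> X. le y x \<and> y \<noteq> x})"
      have "countable ?K" using count[OF True] by simp
      moreover have "?K \<subseteq> X" using 2 True by auto
      ultimately obtain z where "z \<in> X" "\<forall>k\<in>?K. (k, z) \<in> w \<and> k \<noteq> z" using bound by blast
      then show ?thesis by (intro exI[of _ z]) auto
    qed auto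
  qed
  then obtain \<rho> where \<rho>: "\<And>x. x \<in> X \<Longrightarrow> \<rho> x \<in> X" "\<And>x. x \<in> X \<Longrightarrow> (x, \<rho> x) \<in> w"
    "\<And>x y. x \<in> X \<Longrightarrow> y \<in> X \<Longrightarrow> le y x \<Longrightarrow> y \<noteq> x \<Longrightarrow> (\<rho> y, \<rho> x) \<in> w - Id"
    by auto
  define R where "R = inv_image ((w - Id) <*lex*> (w - Id)) (\<lambda>x. (\<rho> x, x)) \<inter> X \<times> X"
  show thesis
  proof
    show "wf R" unfolding R_def by (intro wf_Int1 wf_inv_image wf_lex_prod wfw)
    show "R \<subseteq> X \<times> X" by (simp add: R_def)
    show "\<forall>x\<in>X. \<forall>y\<in>X. x \<noteq> y \<longrightarrow> (x, y) \<in> R \<or> (y, x) \<in> R"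
      using lin(4) \<rho>(1) by (auto simp: R_def total_on_def)
    show "\<forall>x. countable {y. (y, x) \<in> R}"
    proof (intro allI countable_subset[OF _ seg])
      fix x
      \<comment> \<open>In \<open>w\<close> one has \<open>y \<le> \<rho> y \<le> \<rho> x\<close>,
        so all predecessors of \<open>x\<close> lie in a single countable segment.\<close>
      show "{y. (y, x) \<in> R} \<subseteq> {y. (y, \<rho> x) \<in> w}"
      proof safe
        fix y assume "(y, x) \<in> R"
        then have "y \<in> X" "(\<rho> y, \<rho> x) \<in> w"
          using \<rho>(1) lin(1) by (auto simp: R_def refl_on_def)
        then show "(y, \<rho> x) \<in> w" using \<rho>(2) lin(3) by (meson transD)
      qed
    qed
    show "\<forall>x\<in>X. \<forall>y\<in>X. le x y \<and> x \<noteq> y \<longrightarrow> (x, y) \<in> R"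
      using \<rho>(3) by (auto simp: R_def)
  qed
qed

text \<open>\<open>R\<close> is a strict well-order of type \<open>omega_1\<close> on
  \<open>X\<close> extending the strict part of \<open>le\<close>. A recursion along
  \<open>R\<close> therefore meets everything strictly below \<open>x\<close> before
  \<open>x\<close>, and has only countably many earlier sets to handle at each stage.\<close>

locale omega1_semilattice =
  fixes X :: "'a set" and le :: "'a \<Rightarrow> 'a \<Rightarrow> bool"
    and meet :: "'a \<Rightarrow> 'a \<Rightarrow> 'a" and R :: "('a \<times> 'a) set"
  assumes le_refl: "x \<in> X \<Longrightarrow> le x x"
    and le_antisym: "x \<in> X \<Longrightarrow> y \<in> X \<Longrightarrow> le x y \<Longrightarrow> le y x \<Longrightarrow> x = y"
    and le_trans: "x \<in> X \<Longrightarrow> y \<in> X \<Longrightarrow> z \<in> X \<Longrightarrow> le x y \<Longrightarrow> le y z \<Longrightarrow> le x z"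
    and meet_closed: "x \<in> X \<Longrightarrow> y \<in> X \<Longrightarrow> meet x y \<in> X"
    and meet_le1: "x \<in> X \<Longrightarrow> y \<in> X \<Longrightarrow> le (meet x y) x"
    and meet_le2: "x \<in> X \<Longrightarrow> y \<in> X \<Longrightarrow> le (meet x y) y"
    and meet_greatest: "x \<in> X \<Longrightarrow> y \<in> X \<Longrightarrow> z \<in> X \<Longrightarrow> le z x \<Longrightarrow> le z y \<Longrightarrow> le z (meet x y)"
    and uncountable_carrier: "uncountable X"
    and wf_R: "wf R"
    and R_carrier: "R \<subseteq> X \<times> X"
    and R_total: "x \<in> X \<Longrightarrow> y \<in> X \<Longrightarrow> x \<noteq> y \<Longrightarrow> (x, y) \<in> R \<or> (y, x) \<in> R"
    and R_countable: "countable {y. (y, x) \<in> R}"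
    and R_extends: "x \<in> X \<Longrightarrow> y \<in> X \<Longrightarrow> le x y \<Longrightarrow> x \<noteq> y \<Longrightarrow> (x, y) \<in> R"
begin

definition below :: "'a \<Rightarrow> 'a set" where
  "below x = {y \<in> X. le y x \<and> y \<noteq> x}"

lemma belowD: "y \<in> below x \<Longrightarrow> y \<in> X" "y \<in> below x \<Longrightarrow> le y x"
  by (simp_all add: below_def)

lemma below_R: "x \<in> X \<Longrightarrow> y \<in> below x \<Longrightarrow> (y, x) \<in> R"
  by (simp add: below_def R_extends)

lemma countable_below: "x \<in> X \<Longrightarrow> countable (below x)"
  by (rule countable_subset[OF _ R_countable[of x]]) (auto intro: below_R)

lemma meet_absorb: "x \<in> X \<Longrightarrow> y \<in> X \<Longrightarrow> le y x \<Longrightarrow> meet x y = y"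
  by (meson le_antisym le_refl meet_closed meet_greatest meet_le2)

lemma meet_commute: "x \<in> X \<Longrightarrow> y \<in> X \<Longrightarrow> meet x y = meet y x"
  by (meson le_antisym meet_closed meet_greatest meet_le1 meet_le2)

lemma R_asym: "(x, y) \<in> R \<Longrightarrow> (y, x) \<notin> R"
  using wf_R by (rule wf_not_sym)

text \<open>If the meet were \<open>x\<close>, then \<open>x\<close> would lie below
  \<open>z\<close>, against the direction of \<open>R\<close>. Hence, when a recursion reaches
  \<open>x\<close>, the set prescribed for the intersection with an earlier set has already been
  built.\<close>

lemma meet_below:
  assumes "(z, x) \<in> R"
  shows "meet x z \<in> below x"
proof -
  have X: "x \<in> X" "z \<in> X" using assms R_carrier by auto
  have "meet x z \<noteq> x"
  proof
    assume "meet x z = x"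
    then have "le x z" using meet_le2 X by metis
    then show False using X assms R_asym R_extends wf_R by blast
  qed
  then show ?thesis using X by (simp add: below_def meet_closed meet_le1)
qed

text \<open>The segments under a countably infinite \<open>K\<close> have countable union, so some
  element of \<open>Z\<close> comes after all of \<open>K\<close>. This will contradict the
  finiteness clause of \<open>luzin_family\<close>.\<close>

lemma uncountable_R_bound:
  assumes "uncountable Z" "Z \<subseteq> X"
  obtains y K where "y \<in> Z" "K \<subseteq> Z" "infinite K" "\<forall>k\<in>K. (k, y) \<in> R"
proof -
  have "infinite Z" using assms(1) countable_finite by blast
  then obtain K where K: "K \<subseteq> Z" "countable K" "infinite K"
    using infinite_countable_subset' by blast
  have "countable (K \<union> (\<Union>k\<in>K. {y. (y, k) \<in> R}))" using K R_countable by simp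
  then obtain y where y: "y \<in> Z" "y \<notin> K \<union> (\<Union>k\<in>K. {y. (y, k) \<in> R})"
    using assms(1) countable_subset[of Z] by (metis subsetI)
  have "\<forall>k\<in>K. (k, y) \<in> R"
  proof
    fix k assume k: "k \<in> K"
    then have "k \<in> X" "y \<in> X" "k \<noteq> y" "(y, k) \<notin> R" using y K(1) assms(2) by auto
    then show "(k, y) \<in> R" using R_total by blast
  qed
  with y(1) K(1,3) show thesis by (rule that)
qed

section \<open>Representations of the semilattice modulo finite sets\<close>

text \<open>The private part \<open>D x\<close> serves twice: it witnesses that \<open>B x\<close>
  is not almost contained in \<open>B z\<close> when \<open>x\<close> is not below \<open>z\<close>,
  and it is a region where a coherent system may be altered at \<open>x\<close> without disturbing
  its agreement with the values below \<open>x\<close>.\<close>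

definition represents :: "('a \<Rightarrow> nat set) \<Rightarrow> ('a \<Rightarrow> nat set) \<Rightarrow> bool" where
  "represents B D \<longleftrightarrow>
     (\<forall>x\<in>X. D x \<subseteq> B x \<and> infinite (D x)) \<and>
     (\<forall>x\<in>X. \<forall>y\<in>X. \<forall>\<^sub>\<infinity>p. p \<in> B x \<and> p \<in> B y \<longleftrightarrow> p \<in> B (meet x y)) \<and>
     (\<forall>x\<in>X. \<forall>z\<in>X. \<not> le x z \<longrightarrow> finite (D x \<inter> B z))"

lemma representsD:
  assumes "represents B D"
  shows "x \<in> X \<Longrightarrow> D x \<subseteq> B x" "x \<in> X \<Longrightarrow> infinite (D x)"
    "x \<in> X \<Longrightarrow> y \<in> X \<Longrightarrow> \<forall>\<^sub>\<infinity>p. p \<in> B x \<and> p \<in> B y \<longleftrightarrow> p \<in> B (meet x y)"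
    "x \<in> X \<Longrightarrow> z \<in> X \<Longrightarrow> \<not> le x z \<Longrightarrow> finite (D x \<inter> B z)"
  using assms unfolding represents_def by blast+

lemma represents_mono:
  assumes "represents B D" "x \<in> X" "y \<in> X" "le y x"
  shows "\<forall>\<^sub>\<infinity>p. p \<in> B y \<longrightarrow> p \<in> B x"
  using representsD(3)[OF assms(1-3)]
  unfolding meet_absorb[OF assms(2-4)] by eventually_elim auto

lemma represents_le_iff:
  assumes "represents B D" "x \<in> X" "y \<in> X"
  shows "le x y \<longleftrightarrow> subset_star (B x) (B y)"
proof
  assume "subset_star (B x) (B y)"
  then have "\<forall>\<^sub>\<infinity>p. p \<in> D x \<longrightarrow> p \<in> D x \<inter> B y"
    unfolding subset_star_iff using representsD(1)[OF assms(1,2)] by (auto elim: eventually_mono)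
  show "le x y"
  proof (rule ccontr)
    assume "\<not> le x y"
    then have "\<forall>\<^sub>\<infinity>p. p \<notin> D x \<inter> B y"
      unfolding eventually_cofinite_not_mem by (rule representsD(4)[OF assms])
    with \<open>\<forall>\<^sub>\<infinity>p. p \<in> D x \<longrightarrow> p \<in> D x \<inter> B y\<close> have "\<forall>\<^sub>\<infinity>p. p \<notin> D x" by eventually_elim auto
    then show False
      using representsD(2)[OF assms(1,2)] by (simp only: eventually_cofinite_not_mem)
  qed
qed (use assms represents_mono subset_star_iff in blast)

section \<open>Coherent systems indexed by \<open>X\<close>\<close>

definition coherent :: "('a \<Rightarrow> nat set) \<Rightarrow> ('a \<Rightarrow> nat set) \<Rightarrow> bool" where
  "coherent B G \<longleftrightarrow>
     (\<forall>x\<in>X. G x \<subseteq> B x) \<and>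
     (\<forall>x\<in>X. \<forall>y\<in>X. le y x \<longrightarrow> (\<forall>\<^sub>\<infinity>p. p \<in> B y \<longrightarrow> (p \<in> G x \<longleftrightarrow> p \<in> G y)))"

definition trivial :: "('a \<Rightarrow> nat set) \<Rightarrow> ('a \<Rightarrow> nat set) \<Rightarrow> bool" where
  "trivial B G \<longleftrightarrow> (\<exists>C. \<forall>x\<in>X. \<forall>\<^sub>\<infinity>p. p \<in> B x \<longrightarrow> (p \<in> C \<longleftrightarrow> p \<in> G x))"

lemma coherentI_below:
  assumes "\<And>x. x \<in> X \<Longrightarrow> G x \<subseteq> B x"
    and "\<And>x y. x \<in> X \<Longrightarrow> y \<in> below x \<Longrightarrow> \<forall>\<^sub>\<infinity>p. p \<in> B y \<longrightarrow> (p \<in> G x \<longleftrightarrow> p \<in> G y)"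
  shows "coherent B G"
  unfolding coherent_def
proof (intro conjI ballI impI)
  fix x y assume "x \<in> X" "y \<in> X" "le y x"
  then show "\<forall>\<^sub>\<infinity>p. p \<in> B y \<longrightarrow> (p \<in> G x \<longleftrightarrow> p \<in> G y)"
    using assms(2)[of x y] by (cases "y = x") (auto simp: below_def)
qed (use assms(1) in auto)

text \<open>Enumerate the predecessors of \<open>x\<close>; on \<open>B y\<close> minus the earlier sets follow \<open>G y\<close>.\<close>
lemma coherent_extension:
  assumes rep: "represents B D" and x: "x \<in> X"
    and coh: "\<And>y u. y \<in> below x \<Longrightarrow> u \<in> below y \<Longrightarrow> \<forall>\<^sub>\<infinity>p. p \<in> B u \<longrightarrow> (p \<in> G y \<longleftrightarrow> p \<in> G u)"
  obtains v where "v \<subseteq> B x"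
    "\<And>y. y \<in> below x \<Longrightarrow> \<forall>\<^sub>\<infinity>p. p \<in> B y \<longrightarrow> (p \<in> v \<longleftrightarrow> p \<in> G y)"
proof -
  define e where "e = to_nat_on (below x)"
  define v where "v = {p \<in> B x. \<exists>y\<in>below x. p \<in> B y \<and> p \<in> G y \<and>
    (\<forall>z\<in>below x. e z < e y \<longrightarrow> p \<notin> B z)}"
  have coh': "\<forall>\<^sub>\<infinity>p. p \<in> B u \<longrightarrow> (p \<in> G y \<longleftrightarrow> p \<in> G u)"
    if "y \<in> below x" "u \<in> X" "le u y" for y u
    using that coh[of y u] by (cases "u = y") (auto simp: below_def)
  show thesis
  proof
    show "v \<subseteq> B x" by (auto simp: v_def)
  next
    fix u assume u: "u \<in> below x"
    \<comment> \<open>Only a set of index at most \<open>e u\<close> can be the first one to contain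
      a point of \<open>B u\<close>, so finitely many agreements with \<open>G u\<close>
      suffice.\<close>
    define F where "F = {y \<in> below x. e y \<le> e u}"
    have fin: "finite F"
      unfolding F_def e_def by (rule finite_to_nat_on_le[OF countable_below[OF x]])
    have "\<forall>\<^sub>\<infinity>p. \<forall>y\<in>F. p \<in> B y \<and> p \<in> B u \<longrightarrow> (p \<in> G y \<longleftrightarrow> p \<in> G u)"
    proof (rule eventually_ball_finite[OF fin], rule ballI)
      \<comment> \<open>The overlap of \<open>B y\<close> and \<open>B u\<close> is almost
        \<open>B (meet y u)\<close>, and there both \<open>G y\<close> and \<open>G u\<close> agree
        with \<open>G (meet y u)\<close>.\<close>
      fix y assume "y \<in> F"
      then have y: "y \<in> below x" by (simp add: F_def)
      have X: "y \<in> X" "u \<in> X" using y u by (auto dest: belowD)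
      note m = meet_closed[OF X] meet_le1[OF X] meet_le2[OF X]
      show "\<forall>\<^sub>\<infinity>p. p \<in> B y \<and> p \<in> B u \<longrightarrow> (p \<in> G y \<longleftrightarrow> p \<in> G u)"
        using representsD(3)[OF rep X] coh'[OF y m(1,2)] coh'[OF u m(1,3)]
        by eventually_elim auto
    qed
    moreover have "\<forall>\<^sub>\<infinity>p. p \<in> B u \<longrightarrow> p \<in> B x"
      using represents_mono[OF rep x] u by (auto dest: belowD)
    ultimately show "\<forall>\<^sub>\<infinity>p. p \<in> B u \<longrightarrow> (p \<in> v \<longleftrightarrow> p \<in> G u)"
    proof eventually_elim
      case (elim p)
      show ?case
      proof (intro impI iffI)
        assume pu: "p \<in> B u" and "p \<in> v"
        then obtain y where y: "y \<in> below x" "p \<in> B y" "p \<in> G y"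
          "\<forall>z\<in>below x. e z < e y \<longrightarrow> p \<notin> B z" by (auto simp: v_def)
        then have "y \<in> F" using u pu by (auto simp: F_def not_less[symmetric])
        then show "p \<in> G u" using elim y pu by blast
      next
        assume pu: "p \<in> B u" and "p \<in> G u"
        obtain y where y: "y \<in> below x \<and> p \<in> B y"
          "\<forall>z. z \<in> below x \<and> p \<in> B z \<longrightarrow> e y \<le> e z"
          using ex_has_least_nat[of "\<lambda>y. y \<in> below x \<and> p \<in> B y" u e] u pu by blast
        then have "y \<in> F" using u pu by (auto simp: F_def)
        then have "p \<in> G y" using elim y pu \<open>p \<in> G u\<close> by blast
        then show "p \<in> v" using elim pu y by (auto simp: v_def not_le[symmetric])
      qed
    qed
  qed
qed

text \<open>Recursion along \<open>R\<close>: extend the part below \<open>x\<close>, then overwrite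
  the result on \<open>D x\<close> as \<open>S\<close> dictates. This costs only finitely many
  points on each \<open>B y\<close> with \<open>y\<close> strictly below \<open>x\<close>. Different
  subsets of \<open>X\<close> thus give systems that differ modulo finite.\<close>

lemma coherent_with_prescribed_pattern:
  assumes rep: "represents B D"
  obtains G where "coherent B G" "\<And>x. x \<in> X \<Longrightarrow> x \<in> S \<Longrightarrow> D x \<subseteq> G x"
    "\<And>x. x \<in> X \<Longrightarrow> x \<notin> S \<Longrightarrow> D x \<inter> G x = {}"
proof -
  define P where "P G x v \<longleftrightarrow> (x \<in> X \<longrightarrow> v \<subseteq> B x \<and>
      (\<forall>y\<in>below x. \<forall>\<^sub>\<infinity>p. p \<in> B y \<longrightarrow> (p \<in> v \<longleftrightarrow> p \<in> G y)) \<and>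
      (if x \<in> S then D x \<subseteq> v else D x \<inter> v = {}))" for G :: "'a \<Rightarrow> nat set" and x v
  have "\<exists>G. \<forall>x. P G x (G x)"
  proof (rule dependent_wf_choice[OF wf_R])
    fix f g :: "'a \<Rightarrow> nat set" and x r
    assume "\<And>z. (z, x) \<in> R \<Longrightarrow> f z = g z"
    then have "x \<in> X \<Longrightarrow> y \<in> below x \<Longrightarrow> f y = g y" for y using below_R by blast
    then show "P f x r = P g x r" by (auto simp: P_def)
  next
    fix x and G :: "'a \<Rightarrow> nat set"
    assume IH: "\<And>y. (y, x) \<in> R \<Longrightarrow> P G y (G y)"
    show "\<exists>v. P G x v"
    proof (cases "x \<in> X")
      case x: True
      have "\<forall>\<^sub>\<infinity>p. p \<in> B u \<longrightarrow> (p \<in> G y \<longleftrightarrow> p \<in> G u)" if "y \<in> below x" "u \<in> below y" for y u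
        using IH[OF below_R[OF x that(1)]] that by (auto simp: P_def dest: belowD)
      from coherent_extension[OF rep x this] obtain v where v: "v \<subseteq> B x"
        "\<And>y. y \<in> below x \<Longrightarrow> \<forall>\<^sub>\<infinity>p. p \<in> B y \<longrightarrow> (p \<in> v \<longleftrightarrow> p \<in> G y)"
        by blast
      define v' where "v' = (if x \<in> S then v \<union> D x else v - D x)"
      have "\<forall>\<^sub>\<infinity>p. p \<in> B y \<longrightarrow> (p \<in> v' \<longleftrightarrow> p \<in> G y)" if y: "y \<in> below x" for y
      proof -
        have "\<not> le x y" using y x le_antisym unfolding below_def by blast
        then have "\<forall>\<^sub>\<infinity>p. p \<notin> D x \<inter> B y"
          unfolding eventually_cofinite_not_mem
          by (rule representsD(4)[OF rep x belowD(1)[OF y]])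
        with v(2)[OF y] show ?thesis by eventually_elim (auto simp: v'_def)
      qed
      then show ?thesis using v(1) representsD(1)[OF rep x]
        by (intro exI[of _ v']) (auto simp: P_def v'_def)
    qed (simp add: P_def)
  qed
  then obtain G where G: "\<And>x. P G x (G x)" by blast
  show thesis
  proof
    show "coherent B G" using G by (intro coherentI_below) (auto simp: P_def)
    show "D x \<subseteq> G x" if "x \<in> X" "x \<in> S" for x
      using G[of x] that unfolding P_def by (simp only: if_True simp_thms)
    show "D x \<inter> G x = {}" if "x \<in> X" "x \<notin> S" for x
      using G[of x] that unfolding P_def by (simp only: if_False simp_thms)
  qed
qed

section \<open>Existence of a representation\<close>

text \<open>Recursion along \<open>R\<close>. The new set must almost contain every earlier set of
  an element below \<open>x\<close>, but meet each earlier \<open>f z\<close> only in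
  \<open>f (meet x z)\<close> modulo finite. Finiteness on initial columns is carried along so that
  a fresh \<open>D\<close> can be found at every stage.\<close>

lemma representation_exists:
  obtains B D where "represents B D"
proof -
  define P where "P f x v \<longleftrightarrow> (x \<in> X \<longrightarrow>
      (\<forall>n. finite {p \<in> v. column p \<le> n}) \<and>
      (\<forall>z. (z, x) \<in> R \<longrightarrow> (\<forall>\<^sub>\<infinity>p. p \<in> v \<and> p \<in> f z \<longleftrightarrow> p \<in> f (meet x z))) \<and>
      (\<exists>D\<subseteq>v. infinite D \<and> (\<forall>z. (z, x) \<in> R \<longrightarrow> finite (D \<inter> f z))))"
    for f :: "'a \<Rightarrow> nat set" and x v
  have "\<exists>B. \<forall>x. P B x (B x)"
  proof (rule dependent_wf_choice[OF wf_R])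
    fix f g :: "'a \<Rightarrow> nat set" and x r
    assume fg: "\<And>z. (z, x) \<in> R \<Longrightarrow> f z = g z"
    have "f (meet x z) = g (meet x z)" if "(z, x) \<in> R" for z
    proof (rule fg)
      have "x \<in> X" using that R_carrier by auto
      then show "(meet x z, x) \<in> R" by (rule below_R[OF _ meet_below[OF that]])
    qed
    then show "P f x r = P g x r" using fg by (simp add: P_def cong: imp_cong)
  next
    fix x and f :: "'a \<Rightarrow> nat set"
    assume IH: "\<And>y. (y, x) \<in> R \<Longrightarrow> P f y (f y)"
    show "\<exists>v. P f x v"
    proof (cases "x \<in> X")
      case x: True
      define A where "A = {z. (z, x) \<in> R}"
      define e where "e = to_nat_on A"
      have A: "countable A" unfolding A_def by (rule R_countable)
      have AX: "z \<in> X" if "z \<in> A" for z using that R_carrier by (auto simp: A_def)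
      have BA: "z \<in> A" if "z \<in> below x" for z using that below_R[OF x] by (simp add: A_def)
      have finA: "finite {z \<in> A. e z \<le> n}" for n
        unfolding e_def by (rule finite_to_nat_on_le[OF A])
      have col: "finite {p \<in> f z. column p \<le> n}" if "z \<in> A" for z n
        using IH[of z] AX[OF that] that by (auto simp: P_def A_def)
      have IH_meet: "\<forall>\<^sub>\<infinity>p. p \<in> f z \<and> p \<in> f u \<longleftrightarrow> p \<in> f (meet z u)"
        if "z \<in> A" "(u, z) \<in> R" for z u
        using IH[of z] AX[OF that(1)] that by (auto simp: P_def A_def)
      have pair: "\<forall>\<^sub>\<infinity>p. p \<in> f y \<and> p \<in> f z \<longrightarrow> p \<in> f (meet y z)" if "y \<in> A" "z \<in> A" for y z
      proof -
        note X = AX[OF that(1)] AX[OF that(2)]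
        consider "y = z" | "(z, y) \<in> R" | "(y, z) \<in> R" using R_total[OF X] by blast
        then show ?thesis
        proof cases
          case 1
          then show ?thesis using X by (simp add: meet_absorb le_refl)
        next
          case 2
          then show ?thesis using IH_meet[OF that(1) 2] by (auto elim: eventually_mono)
        next
          case 3
          then show ?thesis
            using IH_meet[OF that(2) 3] meet_commute[OF X] by (auto elim: eventually_mono)
        qed
      qed
      have mono: "\<forall>\<^sub>\<infinity>p. p \<in> f u \<longrightarrow> p \<in> f z" if "z \<in> A" "u \<in> X" "le u z" for z u
      proof (cases "u = z")
        case False
        then have "(u, z) \<in> R" using R_extends AX that by blast
        from IH_meet[OF that(1) this] show ?thesis
          unfolding meet_absorb[OF AX[OF that(1)] that(2,3)] by eventually_elim auto
      qed auto
      obtain D where D: "infinite D" "\<And>n. finite {p \<in> D. column p \<le> n}"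
        "\<And>z. z \<in> A \<Longrightarrow> finite (D \<inter> f z)"
        using almost_disjoint_transversal[of A f] A col by blast
      define v where "v = D \<union> {p. \<exists>y\<in>below x. e y \<le> column p \<and> p \<in> f y \<and>
        (\<forall>z\<in>A. e z < e y \<longrightarrow> p \<in> f z \<longrightarrow> p \<in> f (meet x z))}"
      have meetA: "meet x z \<in> below x" if "z \<in> A" for z
        using meet_below that by (simp add: A_def)
      \<comment> \<open>For \<open>y\<close> below \<open>x\<close> the meet of \<open>y\<close> and
        \<open>z\<close> lies below that of \<open>x\<close> and \<open>z\<close>, so each single
        pair errs only finitely often.\<close>
      have corr: "\<forall>\<^sub>\<infinity>p. p \<in> f y \<and> p \<in> f z \<longrightarrow> p \<in> f (meet x z)"
        if "y \<in> below x" "z \<in> A" for y z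
      proof -
        note y = belowD[OF that(1)] and z = AX[OF that(2)]
        have "le (meet y z) (meet x z)"
          using meet_closed meet_greatest meet_le1 meet_le2 le_trans x y z by meson
        then have "\<forall>\<^sub>\<infinity>p. p \<in> f (meet y z) \<longrightarrow> p \<in> f (meet x z)"
          by (intro mono BA meetA that(2) meet_closed y z)
        with pair[OF BA[OF that(1)] that(2)] show ?thesis by eventually_elim auto
      qed
      have sub: "\<forall>\<^sub>\<infinity>p. p \<in> f y \<longrightarrow> p \<in> v" if y: "y \<in> below x" for y
      proof -
        have "\<forall>\<^sub>\<infinity>p. p \<notin> {p \<in> f y. column p \<le> e y}"
          unfolding eventually_cofinite_not_mem by (rule col[OF BA[OF y]])
        moreover have "\<forall>\<^sub>\<infinity>p. \<forall>z\<in>{z \<in> A. e z \<le> e y}. p \<in> f y \<and> p \<in> f z \<longrightarrow> p \<in> f (meet x z)"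
          by (rule eventually_ball_finite[OF finA]) (use corr[OF y] in auto)
        ultimately show ?thesis
        proof eventually_elim
          case (elim p)
          show ?case
          proof
            assume "p \<in> f y"
            then have "e y \<le> column p" using elim(1) by simp
            then show "p \<in> v" unfolding v_def using \<open>p \<in> f y\<close> elim(2) y by auto
          qed
        qed
      qed
      have sup: "\<forall>\<^sub>\<infinity>p. p \<in> v \<and> p \<in> f z \<longrightarrow> p \<in> f (meet x z)" if z: "z \<in> A" for z
      proof -
        have "\<forall>\<^sub>\<infinity>p. p \<notin> D \<inter> f z"
          unfolding eventually_cofinite_not_mem by (rule D(3)[OF z])
        moreover have "\<forall>\<^sub>\<infinity>p. \<forall>y\<in>{y \<in> A. e y \<le> e z}. y \<in> below x \<longrightarrow>
            p \<in> f y \<and> p \<in> f z \<longrightarrow> p \<in> f (meet x z)"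
          by (rule eventually_ball_finite[OF finA])
            (use corr[OF _ z] in \<open>auto elim: eventually_mono\<close>)
        ultimately show ?thesis
        proof eventually_elim
          case (elim p)
          show ?case
          proof
            assume p: "p \<in> v \<and> p \<in> f z"
            then have "p \<notin> D" using elim(1) by blast
            then obtain y where y: "y \<in> below x" "p \<in> f y"
              "\<forall>z\<in>A. e z < e y \<longrightarrow> p \<in> f z \<longrightarrow> p \<in> f (meet x z)"
              using p by (auto simp: v_def)
            show "p \<in> f (meet x z)"
            proof (cases "e z < e y")
              case True
              then show ?thesis using y p z by blast
            next
              case False
              then show ?thesis using elim(2) y p BA[OF y(1)] by auto
            qed
          qed
        qed
      qed
      have "P f x v"
        unfolding P_def
      proof (intro impI conjI allI)
        fix n
        have "{p \<in> v. column p \<le> n} \<subseteq>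
            {p \<in> D. column p \<le> n} \<union> (\<Union>y\<in>{y \<in> A. e y \<le> n}. {p \<in> f y. column p \<le> n})"
        proof
          fix p assume "p \<in> {p \<in> v. column p \<le> n}"
          then have p: "p \<in> v" "column p \<le> n" by auto
          show "p \<in> {p \<in> D. column p \<le> n} \<union> (\<Union>y\<in>{y \<in> A. e y \<le> n}. {p \<in> f y. column p \<le> n})"
          proof (cases "p \<in> D")
            case False
            then obtain y where "y \<in> below x" "e y \<le> column p" "p \<in> f y"
              using p(1) by (auto simp: v_def)
            then show ?thesis using BA[of y] p(2) by auto
          qed (use p in simp)
        qed
        then show "finite {p \<in> v. column p \<le> n}"
          by (rule finite_subset) (use D(2) finA col in auto)
      next
        fix z assume "(z, x) \<in> R"
        then have z: "z \<in> A" by (simp add: A_def)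
        have "\<forall>\<^sub>\<infinity>p. p \<in> f (meet x z) \<longrightarrow> p \<in> f z"
          by (rule mono[OF z meet_closed[OF x AX[OF z]] meet_le2[OF x AX[OF z]]])
        with sub[OF meetA[OF z]] sup[OF z]
        show "\<forall>\<^sub>\<infinity>p. p \<in> v \<and> p \<in> f z \<longleftrightarrow> p \<in> f (meet x z)" by eventually_elim blast
      next
        have "D \<subseteq> v" by (simp add: v_def)
        moreover have "finite (D \<inter> f z)" if "(z, x) \<in> R" for z
          using D(3) that by (simp add: A_def)
        ultimately show "\<exists>D\<subseteq>v. infinite D \<and> (\<forall>z. (z, x) \<in> R \<longrightarrow> finite (D \<inter> f z))"
          using D(1) by blast
      qed
      then show ?thesis ..
    qed (simp add: P_def)
  qed
  then obtain B where B: "\<And>x. P B x (B x)" by blast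
  have "\<forall>x\<in>X. \<exists>D\<subseteq>B x. infinite D \<and> (\<forall>z. (z, x) \<in> R \<longrightarrow> finite (D \<inter> B z))"
    using B by (simp add: P_def)
  then obtain D where D: "\<And>x. x \<in> X \<Longrightarrow> D x \<subseteq> B x" "\<And>x. x \<in> X \<Longrightarrow> infinite (D x)"
    "\<And>x z. x \<in> X \<Longrightarrow> (z, x) \<in> R \<Longrightarrow> finite (D x \<inter> B z)" by metis
  have meetR: "\<forall>\<^sub>\<infinity>p. p \<in> B x \<and> p \<in> B z \<longleftrightarrow> p \<in> B (meet x z)" if "(z, x) \<in> R" for x z
    using B[of x] that R_carrier by (auto simp: P_def)
  have meetX: "\<forall>\<^sub>\<infinity>p. p \<in> B x \<and> p \<in> B y \<longleftrightarrow> p \<in> B (meet x y)" if xy: "x \<in> X" "y \<in> X" for x y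
  proof -
    consider "x = y" | "(y, x) \<in> R" | "(x, y) \<in> R" using R_total[OF xy] by blast
    then show ?thesis
    proof cases
      case 1
      then show ?thesis using xy by (simp add: meet_absorb le_refl)
    next
      case 3
      then show ?thesis
        using meetR[of x y] meet_commute[OF xy] by (auto elim: eventually_mono)
    qed (rule meetR)
  qed
  \<comment> \<open>The recursion made \<open>D x\<close> almost disjoint only from earlier sets. An
    arbitrary \<open>z\<close> is reduced to \<open>meet x z\<close>, which precedes
    \<open>x\<close>.\<close>
  have "finite (D x \<inter> B z)" if xz: "x \<in> X" "z \<in> X" "\<not> le x z" for x z
  proof -
    have "meet x z \<noteq> x" using meet_le2[OF xz(1,2)] xz(3) by metis
    then have "(meet x z, x) \<in> R"
      using meet_closed meet_le1 R_extends xz(1,2) by blast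
    then have "\<forall>\<^sub>\<infinity>p. p \<notin> D x \<inter> B (meet x z)"
      unfolding eventually_cofinite_not_mem by (rule D(3)[OF xz(1)])
    with meetX[OF xz(1,2)] have "\<forall>\<^sub>\<infinity>p. p \<notin> D x \<inter> B z"
      by eventually_elim (use D(1)[OF xz(1)] in auto)
    then show ?thesis by (simp only: eventually_cofinite_not_mem)
  qed
  then have "represents B D" using D meetX unfolding represents_def by blast
  then show thesis by (rule that)
qed

section \<open>Nontrivial systems\<close>

text \<open>At stage \<open>x\<close> each earlier \<open>z\<close> receives its own point
  \<open>q z\<close> of \<open>L z\<close>, where the new \<open>G x\<close> is made to disagree
  with \<open>G z\<close>. Agreement from \<open>n\<close> on forces \<open>q z < n\<close>, and the
  points are pushed so far out that this happens for finitely many \<open>z\<close> only.\<close>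

lemma luzin_family:
  obtains G L :: "'a \<Rightarrow> nat set" where "\<forall>x\<in>X. G x \<subseteq> L x"
    "\<forall>x\<in>X. \<forall>y\<in>X. x \<noteq> y \<longrightarrow> finite (L x \<inter> L y)"
    "\<forall>x\<in>X. \<forall>n.
      finite {z. (z, x) \<in> R \<and> (\<forall>p\<in>L x \<inter> L z. n \<le> p \<longrightarrow> (p \<in> G x \<longleftrightarrow> p \<in> G z))}"
proof -
  define P where "P f x v \<longleftrightarrow> (x \<in> X \<longrightarrow>
      infinite (fst v) \<and> (\<forall>n. finite {p \<in> fst v. column p \<le> n}) \<and> snd v \<subseteq> fst v \<and>
      (\<forall>z. (z, x) \<in> R \<longrightarrow> finite (fst v \<inter> fst (f z))) \<and>
      (\<forall>n. finite {z. (z, x) \<in> R \<and>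
        (\<forall>p\<in>fst v \<inter> fst (f z). n \<le> p \<longrightarrow> (p \<in> snd v \<longleftrightarrow> p \<in> snd (f z)))}))"
    for f :: "'a \<Rightarrow> nat set \<times> nat set" and x v
  have "\<exists>f. \<forall>x. P f x (f x)"
  proof (rule dependent_wf_choice[OF wf_R])
    fix f g :: "'a \<Rightarrow> nat set \<times> nat set" and x r
    assume "\<And>z. (z, x) \<in> R \<Longrightarrow> f z = g z"
    then show "P f x r = P g x r" by (simp add: P_def cong: conj_cong imp_cong)
  next
    fix x and f :: "'a \<Rightarrow> nat set \<times> nat set"
    assume IH: "\<And>y. (y, x) \<in> R \<Longrightarrow> P f y (f y)"
    show "\<exists>v. P f x v"
    proof (cases "x \<in> X")
      case x: True
      define A where "A = {z. (z, x) \<in> R}"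
      define e where "e = to_nat_on A"
      define L where "L z = fst (f z)" for z
      define G where "G z = snd (f z)" for z
      have A: "countable A" unfolding A_def by (rule R_countable)
      have AX: "z \<in> X" if "z \<in> A" for z using that R_carrier by (auto simp: A_def)
      have finA: "finite {z \<in> A. e z \<le> n}" for n
        unfolding e_def by (rule finite_to_nat_on_le[OF A])
      have IH': "P f z (f z)" if "z \<in> A" for z using IH that by (simp add: A_def)
      have col: "finite {p \<in> L z. column p \<le> n}" and inf: "infinite (L z)"
        if "z \<in> A" for z n
        using IH'[OF that] AX[OF that] by (auto simp: P_def L_def)
      have ad: "finite (L z \<inter> L u)" if "z \<in> A" "u \<in> A" "u \<noteq> z" for z u
        using IH'[OF that(1)] IH'[OF that(2)] AX[OF that(1)] AX[OF that(2)]
          R_total[OF AX[OF that(1)] AX[OF that(2)]] that(3)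
        by (auto simp: P_def L_def Int_commute)
      \<comment> \<open>\<open>L z\<close> is infinite, while its initial columns and its
        intersections with the finitely many \<open>L u\<close> of smaller index are finite.\<close>
      have "\<exists>p. p \<in> L z \<and> e z \<le> column p \<and> (\<forall>u\<in>A. e u < e z \<longrightarrow> p \<notin> L u)"
        if z: "z \<in> A" for z
      proof -
        have "\<forall>\<^sub>\<infinity>p. p \<notin> {p \<in> L z. column p \<le> e z}"
          unfolding eventually_cofinite_not_mem by (rule col[OF z])
        moreover have "\<forall>\<^sub>\<infinity>p. \<forall>u\<in>{u \<in> A. e u \<le> e z}. u \<noteq> z \<longrightarrow> p \<notin> L z \<inter> L u"
        proof (rule eventually_ball_finite[OF finA], rule ballI)
          fix u assume "u \<in> {u \<in> A. e u \<le> e z}"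
          then show "\<forall>\<^sub>\<infinity>p. u \<noteq> z \<longrightarrow> p \<notin> L z \<inter> L u"
            using ad[OF z, of u]
            by (cases "u = z") (simp_all only: eventually_cofinite_not_mem mem_Collect_eq simp_thms
                eventually_True not_False_eq_True)
        qed
        ultimately have "\<forall>\<^sub>\<infinity>p. p \<in> L z \<longrightarrow>
            e z \<le> column p \<and> (\<forall>u\<in>A. e u < e z \<longrightarrow> p \<notin> L u)"
        proof eventually_elim
          case (elim p)
          then show ?case by auto
        qed
        then show ?thesis by (rule infinite_cofinite_ex[OF inf[OF z]])
      qed
      then obtain q where q: "\<And>z. z \<in> A \<Longrightarrow> q z \<in> L z" "\<And>z. z \<in> A \<Longrightarrow> e z \<le> column (q z)"
        "\<And>z u. z \<in> A \<Longrightarrow> u \<in> A \<Longrightarrow> e u < e z \<Longrightarrow> q z \<notin> L u" by metis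
      have e_inj: "inj_on e A" unfolding e_def by (rule inj_on_to_nat_on[OF A])
      have q_inj: "inj_on q A"
      proof (rule inj_onI)
        fix z u assume zu: "z \<in> A" "u \<in> A" "q z = q u"
        then have "e z = e u" using q(1,3) by (metis linorder_neqE_nat)
        then show "z = u" using e_inj zu by (auto dest: inj_onD)
      qed
      obtain D where D: "infinite D" "\<And>n. finite {p \<in> D. column p \<le> n}"
        "\<And>z. z \<in> A \<Longrightarrow> finite (D \<inter> L z)"
        using almost_disjoint_transversal[of A L] A col by blast
      \<comment> \<open>\<open>D\<close> guarantees that \<open>L'\<close> is infinite, even if
        \<open>x\<close> has few predecessors. Avoiding sets of smaller index makes \<open>q\<close>
        injective, so the choices entering \<open>G'\<close> do not conflict.\<close>
      define L' where "L' = D \<union> q ` A"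
      define G' where "G' = q ` {z \<in> A. q z \<notin> G z}"
      have "P f x (L', G')"
        unfolding P_def fst_conv snd_conv L_def[symmetric] G_def[symmetric]
      proof (intro impI conjI allI)
        show "infinite L'" using D(1) by (simp add: L'_def)
        show "G' \<subseteq> L'" by (auto simp: L'_def G'_def)
      next
        fix n
        have "{p \<in> L'. column p \<le> n} \<subseteq> {p \<in> D. column p \<le> n} \<union> q ` {z \<in> A. e z \<le> n}"
          using q(2) order_trans[where 'a = nat] unfolding L'_def by blast
        then show "finite {p \<in> L'. column p \<le> n}"
          by (rule finite_subset) (use D(2) finA in auto)
      next
        fix z assume "(z, x) \<in> R"
        then have z: "z \<in> A" by (simp add: A_def)
        have "L' \<inter> L z \<subseteq> D \<inter> L z \<union> q ` {u \<in> A. e u \<le> e z}"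
          using q(3) z by (auto simp: L'_def not_less[symmetric])
        then show "finite (L' \<inter> L z)"
          by (rule finite_subset) (use D(3) z finA in auto)
      next
        fix n
        \<comment> \<open>The bound comes from
          \<open>e z \<le> column (q z) \<le> q z < n\<close>.\<close>
        have "z \<in> A \<and> e z \<le> n"
          if "(z, x) \<in> R" "\<forall>p\<in>L' \<inter> L z. n \<le> p \<longrightarrow> (p \<in> G' \<longleftrightarrow> p \<in> G z)" for z
        proof -
          have z: "z \<in> A" using that by (simp add: A_def)
          have "q z \<in> L' \<inter> L z" using z q(1) by (simp add: L'_def)
          moreover have "q z \<in> G' \<longleftrightarrow> q z \<notin> G z"
            using z q_inj by (auto simp: G'_def dest: inj_onD)
          ultimately have "\<not> n \<le> q z" using that(2) by blast
          then show ?thesis using z q(2)[OF z] column_le[of "q z"] by simp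
        qed
        then have "{z. (z, x) \<in> R \<and> (\<forall>p\<in>L' \<inter> L z. n \<le> p \<longrightarrow> (p \<in> G' \<longleftrightarrow> p \<in> G z))}
            \<subseteq> {z \<in> A. e z \<le> n}" by blast
        then show "finite {z. (z, x) \<in> R \<and> (\<forall>p\<in>L' \<inter> L z. n \<le> p \<longrightarrow> (p \<in> G' \<longleftrightarrow> p \<in> G z))}"
          by (rule finite_subset[OF _ finA])
      qed
      then show ?thesis ..
    qed (simp add: P_def)
  qed
  then obtain f where f: "\<And>x. P f x (f x)" by blast
  show thesis
  proof (rule that[of "\<lambda>x. snd (f x)" "\<lambda>x. fst (f x)"])
    show "\<forall>x\<in>X. \<forall>y\<in>X. x \<noteq> y \<longrightarrow> finite (fst (f x) \<inter> fst (f y))"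
    proof (intro ballI impI)
      fix x y assume xy: "x \<in> X" "y \<in> X" "x \<noteq> y"
      then show "finite (fst (f x) \<inter> fst (f y))"
        using f[of x] f[of y] R_total[OF xy] by (auto simp: P_def Int_commute)
    qed
  qed (use f in \<open>simp_all add: P_def\<close>)
qed

text \<open>The condition is one-sided: making \<open>G x\<close> smaller never destroys it, so the
  points removed from \<open>G x\<close> for the sake of different \<open>u\<close> do not interfere with each other.\<close>
lemma hausdorff_system:
  assumes rep: "represents B D"
  obtains G where "coherent B G"
    "\<And>x n. x \<in> X \<Longrightarrow> finite {u \<in> below x. G u \<inter> B x - G x \<subseteq> {..<n}}"
proof -
  \<comment> \<open>Requiring \<open>D x \<subseteq> v\<close> ensures that, at later stages, points
    picked in \<open>D u\<close> belong to \<open>G u\<close>; removing them from the new value then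
    creates elements of the difference.\<close>
  define P where "P G x v \<longleftrightarrow> (x \<in> X \<longrightarrow> v \<subseteq> B x \<and> D x \<subseteq> v \<and>
      (\<forall>y\<in>below x. \<forall>\<^sub>\<infinity>p. p \<in> B y \<longrightarrow> (p \<in> v \<longleftrightarrow> p \<in> G y)) \<and>
      (\<forall>n. finite {u \<in> below x. G u \<inter> B x - v \<subseteq> {..<n}}))" for G :: "'a \<Rightarrow> nat set" and x v
  have "\<exists>G. \<forall>x. P G x (G x)"
  proof (rule dependent_wf_choice[OF wf_R])
    fix f g :: "'a \<Rightarrow> nat set" and x r
    assume "\<And>z. (z, x) \<in> R \<Longrightarrow> f z = g z"
    then have "x \<in> X \<Longrightarrow> y \<in> below x \<Longrightarrow> f y = g y" for y using below_R by blast
    then show "P f x r = P g x r" by (simp add: P_def cong: conj_cong imp_cong)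
  next
    fix x and G :: "'a \<Rightarrow> nat set"
    assume IH: "\<And>y. (y, x) \<in> R \<Longrightarrow> P G y (G y)"
    show "\<exists>v. P G x v"
    proof (cases "x \<in> X")
      case x: True
      have IH': "G y \<subseteq> B y" "D y \<subseteq> G y"
        "\<And>u. u \<in> below y \<Longrightarrow> \<forall>\<^sub>\<infinity>p. p \<in> B u \<longrightarrow> (p \<in> G y \<longleftrightarrow> p \<in> G u)"
        "\<And>n. finite {u \<in> below y. G u \<inter> B y - G y \<subseteq> {..<n}}" if "y \<in> below x" for y
        using IH[OF below_R[OF x that]] belowD(1)[OF that] by (auto simp: P_def)
      define e where "e = to_nat_on (below x)"
      have finB: "finite {y \<in> below x. e y \<le> n}" for n
        unfolding e_def by (rule finite_to_nat_on_le[OF countable_below[OF x]])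
      obtain v0 where v0: "v0 \<subseteq> B x"
        "\<And>y. y \<in> below x \<Longrightarrow> \<forall>\<^sub>\<infinity>p. p \<in> B y \<longrightarrow> (p \<in> v0 \<longleftrightarrow> p \<in> G y)"
        using coherent_extension[OF rep x IH'(3)] by blast
      define v1 where "v1 = v0 \<union> D x"
      have Dx: "\<forall>\<^sub>\<infinity>p. p \<notin> D x \<inter> B y" if "y \<in> below x" for y
      proof -
        have "\<not> le x y" using that x le_antisym unfolding below_def by blast
        then show ?thesis
          unfolding eventually_cofinite_not_mem
          by (rule representsD(4)[OF rep x belowD(1)[OF that]])
      qed
      have v1: "\<forall>\<^sub>\<infinity>p. p \<in> B y \<longrightarrow> (p \<in> v1 \<longleftrightarrow> p \<in> G y)" if "y \<in> below x" for y
        using v0(2)[OF that] Dx[OF that] by eventually_elim (auto simp: v1_def)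
      have Bx: "\<forall>\<^sub>\<infinity>p. p \<in> B y \<longrightarrow> p \<in> B x" if "y \<in> below x" for y
        by (rule represents_mono[OF rep x belowD[OF that]])
      \<comment> \<open>Beyond some \<open>N\<close>, points of \<open>B y\<close> lie in
        \<open>B x\<close>, and there \<open>v\<close> coincides with \<open>G y\<close>. So a
        \<open>u\<close> strictly below \<open>y\<close> that violates the condition at
        \<open>x\<close> already violates it at \<open>y\<close> with bound \<open>max n N\<close>,
        and the induction hypothesis applies.\<close>
      have key: "finite {u \<in> below x. le u y \<and> G u \<inter> B x - v \<subseteq> {..<n}}"
        if y: "y \<in> below x" and v: "\<forall>\<^sub>\<infinity>p. p \<in> B y \<longrightarrow> (p \<in> v \<longleftrightarrow> p \<in> G y)" for y v n
      proof -
        from v Bx[OF y] have "\<forall>\<^sub>\<infinity>p. p \<in> B y \<longrightarrow> (p \<in> v \<longleftrightarrow> p \<in> G y) \<and> p \<in> B x"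
          by eventually_elim auto
        from eventually_cofinite_nat_bound[OF this] obtain N
          where N: "\<forall>p\<ge>N. p \<in> B y \<longrightarrow> (p \<in> v \<longleftrightarrow> p \<in> G y) \<and> p \<in> B x" ..
        have "{u \<in> below x. le u y \<and> G u \<inter> B x - v \<subseteq> {..<n}} \<subseteq>
            insert y {u \<in> below y. G u \<inter> B y - G y \<subseteq> {..<max n N}}"
        proof safe
          fix u p
          assume u: "u \<in> below x" "le u y" "G u \<inter> B x - v \<subseteq> {..<n}"
            and p: "p \<in> G u" "p \<in> B y" "p \<notin> G y"
          show "p < max n N"
            using N u(3) p by (cases "N \<le> p") auto
        qed (auto simp: below_def)
        then show ?thesis by (rule finite_subset) (use IH'(4)[OF y] in simp)
      qed
      have "\<forall>u\<in>below x. \<exists>y. (y \<in> below x \<and> le u y) \<and>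
          (\<forall>z. z \<in> below x \<and> le u z \<longrightarrow> e y \<le> e z)"
        using ex_has_least_nat[of "\<lambda>y. y \<in> below x \<and> le u y" u e for u] le_refl belowD(1)
        by blast
      \<comment> \<open>\<open>t u\<close> is the element of least index among those strictly below
        \<open>x\<close> that lie above \<open>u\<close>. It sorts the predecessors of
        \<open>x\<close> into countably many groups, to each of which \<open>key\<close>
        applies.\<close>
      then obtain t where t: "\<And>u. u \<in> below x \<Longrightarrow> t u \<in> below x"
        "\<And>u. u \<in> below x \<Longrightarrow> le u (t u)"
        "\<And>u z. u \<in> below x \<Longrightarrow> z \<in> below x \<Longrightarrow> le u z \<Longrightarrow> e (t u) \<le> e z" by metis
      have "\<forall>u\<in>below x. \<exists>m. m \<in> D u \<and> m \<in> B x \<and> m \<notin> D x \<and> e (t u) \<le> m \<and>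
          (\<forall>z\<in>below x. e z < e (t u) \<longrightarrow> m \<notin> B z)"
      proof
        fix u assume u: "u \<in> below x"
        note uX = belowD(1)[OF u]
        have "\<forall>\<^sub>\<infinity>p. \<forall>z\<in>{z \<in> below x. e z \<le> e (t u)}. e z < e (t u) \<longrightarrow> p \<notin> D u \<inter> B z"
        proof (rule eventually_ball_finite[OF finB], rule ballI)
          fix z assume z: "z \<in> {z \<in> below x. e z \<le> e (t u)}"
          show "\<forall>\<^sub>\<infinity>p. e z < e (t u) \<longrightarrow> p \<notin> D u \<inter> B z"
          proof (cases "e z < e (t u)")
            case True
            then have "\<not> le u z" using t(3)[OF u, of z] z by auto
            then have "\<forall>\<^sub>\<infinity>p. p \<notin> D u \<inter> B z"
              unfolding eventually_cofinite_not_mem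
              using representsD(4)[OF rep uX] z belowD(1) by blast
            then show ?thesis by eventually_elim auto
          qed simp
        qed
        moreover have "\<forall>\<^sub>\<infinity>p. e (t u) \<le> p"
          by (simp add: eventually_cofinite not_le)
        ultimately have "\<forall>\<^sub>\<infinity>p. p \<in> D u \<longrightarrow> p \<in> B x \<and> p \<notin> D x \<and> e (t u) \<le> p \<and>
            (\<forall>z\<in>below x. e z < e (t u) \<longrightarrow> p \<notin> B z)"
          using Bx[OF u] Dx[OF u]
          by eventually_elim (use representsD(1)[OF rep uX] in auto)
        then show "\<exists>m. m \<in> D u \<and> m \<in> B x \<and> m \<notin> D x \<and> e (t u) \<le> m \<and>
          (\<forall>z\<in>below x. e z < e (t u) \<longrightarrow> m \<notin> B z)"
          by (rule infinite_cofinite_ex[OF representsD(2)[OF rep uX]])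
      qed
      \<comment> \<open>No \<open>z\<close> of index below \<open>e (t u)\<close> lies above
        \<open>u\<close>, so \<open>D u\<close> is almost disjoint from these finitely many
        \<open>B z\<close> and has room for \<open>m u\<close>.\<close>
      from bchoice[OF this] obtain m where
        "\<forall>u\<in>below x. m u \<in> D u \<and> m u \<in> B x \<and> m u \<notin> D x \<and> e (t u) \<le> m u \<and>
          (\<forall>z\<in>below x. e z < e (t u) \<longrightarrow> m u \<notin> B z)" ..
      then have m: "\<And>u. u \<in> below x \<Longrightarrow> m u \<in> D u"
        "\<And>u. u \<in> below x \<Longrightarrow> m u \<in> B x" "\<And>u. u \<in> below x \<Longrightarrow> m u \<notin> D x"
        "\<And>u. u \<in> below x \<Longrightarrow> e (t u) \<le> m u"
        "\<And>u z. u \<in> below x \<Longrightarrow> z \<in> below x \<Longrightarrow> e z < e (t u) \<Longrightarrow> m u \<notin> B z" by simp_all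
      \<comment> \<open>The elements whose difference from \<open>v1\<close> does not yet reach
        \<open>e (t u)\<close>. Each is repaired by removing the single point
        \<open>m u\<close>.\<close>
      define bad where "bad = {u \<in> below x. G u \<inter> B x - v1 \<subseteq> {..<e (t u)}}"
      define v where "v = v1 - m ` bad"
      \<comment> \<open>A removed point \<open>m u\<close> in \<open>B y\<close> has
        \<open>e (t u) \<le> e y\<close>. Hence \<open>u\<close> belongs to one of finitely many
        groups, and \<open>key\<close> for \<open>v1\<close> leaves finitely many bad elements in
        each.\<close>
      have v_coh: "\<forall>\<^sub>\<infinity>p. p \<in> B y \<longrightarrow> (p \<in> v \<longleftrightarrow> p \<in> G y)" if y: "y \<in> below x" for y
      proof -
        have "m ` bad \<inter> B y \<subseteq> m ` (\<Union>y'\<in>{y' \<in> below x. e y' \<le> e y}.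
            {u \<in> below x. le u y' \<and> G u \<inter> B x - v1 \<subseteq> {..<e y'}})"
        proof
          fix p assume "p \<in> m ` bad \<inter> B y"
          then obtain u where u: "p = m u" "u \<in> bad" "m u \<in> B y" by auto
          then have ub: "u \<in> below x" by (simp add: bad_def)
          then have "e (t u) \<le> e y" using m(5)[OF ub y] u(3) not_le by blast
          then have "u \<in> (\<Union>y'\<in>{y' \<in> below x. e y' \<le> e y}.
            {u \<in> below x. le u y' \<and> G u \<inter> B x - v1 \<subseteq> {..<e y'}})"
            using u(2) t(1,2)[OF ub] ub by (auto simp: bad_def)
          then show "p \<in> m ` (\<Union>y'\<in>{y' \<in> below x. e y' \<le> e y}.
            {u \<in> below x. le u y' \<and> G u \<inter> B x - v1 \<subseteq> {..<e y'}})" using u(1) by blast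
        qed
        moreover have "finite (\<Union>y'\<in>{y' \<in> below x. e y' \<le> e y}.
            {u \<in> below x. le u y' \<and> G u \<inter> B x - v1 \<subseteq> {..<e y'}})"
          using finB key v1 by auto
        ultimately have "finite (m ` bad \<inter> B y)" by (meson finite_imageI finite_subset)
        then have "\<forall>\<^sub>\<infinity>p. p \<notin> m ` bad \<inter> B y" by (simp only: eventually_cofinite_not_mem)
        with v1[OF y] show ?thesis by eventually_elim (auto simp: v_def)
      qed
      have "P G x v"
        unfolding P_def
      proof (intro impI conjI ballI allI v_coh)
        show "v \<subseteq> B x" using v0(1) representsD(1)[OF rep x] by (auto simp: v_def v1_def)
        show "D x \<subseteq> v" using m(3) by (auto simp: v_def v1_def bad_def)
      next
        fix n
        have "{u \<in> below x. G u \<inter> B x - v \<subseteq> {..<n}} \<subseteq> (\<Union>y\<in>{y \<in> below x. e y \<le> n}.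
            {u \<in> below x. le u y \<and> G u \<inter> B x - v \<subseteq> {..<n}})"
        proof
          fix u assume "u \<in> {u \<in> below x. G u \<inter> B x - v \<subseteq> {..<n}}"
          then have u: "u \<in> below x" and sub: "G u \<inter> B x - v \<subseteq> {..<n}" by auto
          \<comment> \<open>Whether \<open>u\<close> was repaired or was not bad, its difference
            from \<open>v\<close> contains a point at or beyond \<open>e (t u)\<close>. So
            \<open>u\<close> lies in one of finitely many groups, and \<open>key\<close> applies to
            \<open>v\<close> itself.\<close>
          have "e (t u) \<le> n"
          proof (cases "u \<in> bad")
            case True
            then have "m u \<in> G u \<inter> B x - v" using m(1,2)[OF u] IH'(2)[OF u] by (auto simp: v_def)
            then show ?thesis using sub m(4)[OF u] by auto
          next
            case False
            then have "\<not> G u \<inter> B x - v1 \<subseteq> {..<e (t u)}" using u by (simp add: bad_def)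
            then obtain p where "p \<in> G u \<inter> B x - v1" "p \<notin> {..<e (t u)}" by blast
            then show ?thesis using sub by (auto simp: v_def)
          qed
          then show "u \<in> (\<Union>y\<in>{y \<in> below x. e y \<le> n}.
            {u \<in> below x. le u y \<and> G u \<inter> B x - v \<subseteq> {..<n}})" using u sub t(1,2)[OF u] by blast
        qed
        then show "finite {u \<in> below x. G u \<inter> B x - v \<subseteq> {..<n}}"
          by (rule finite_subset) (use finB key v_coh in auto)
      qed
      then show ?thesis ..
    qed (simp add: P_def)
  qed
  then obtain G where G: "\<And>x. P G x (G x)" by blast
  show thesis
  proof
    show "coherent B G" using G by (intro coherentI_below) (auto simp: P_def)
  qed (use G in \<open>simp add: P_def\<close>)
qed

section \<open>Nontriviality in the sparse and the dense case\<close>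

text \<open>Sparseness makes each \<open>E x\<close> a finite union of almost disjoint sets, so
  meets and coherence are respected modulo finite. A trivialising set would induce almost every
  \<open>H y\<close> on \<open>L y\<close>, with one threshold for uncountably many
  \<open>y\<close>, which the Luzin property forbids.\<close>

lemma nontrivial_system_sparse:
  assumes Y: "Y \<subseteq> X" "uncountable Y" and sparse: "\<And>x. x \<in> X \<Longrightarrow> finite {y \<in> Y. le y x}"
  obtains B D G where "represents B D" "coherent B G" "\<not> trivial B G"
proof -
  obtain B D where rep: "represents B D" by (rule representation_exists)
  obtain H L :: "'a \<Rightarrow> nat set" where HL: "\<forall>x\<in>X. H x \<subseteq> L x"
    and ad: "\<forall>x\<in>X. \<forall>y\<in>X. x \<noteq> y \<longrightarrow> finite (L x \<inter> L y)"
    and luzin: "\<forall>x\<in>X. \<forall>n.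
      finite {z. (z, x) \<in> R \<and> (\<forall>p\<in>L x \<inter> L z. n \<le> p \<longrightarrow> (p \<in> H x \<longleftrightarrow> p \<in> H z))}"
    by (rule luzin_family)
  have H: "H x \<subseteq> L x" if "x \<in> X" for x using HL that by blast
  define E where "E x = (\<Union>y\<in>{y \<in> Y. le y x}. L y)" for x
  define K where "K x = (\<Union>y\<in>{y \<in> Y. le y x}. H y)" for x
  \<comment> \<open>Apart from finitely many \<open>p\<close>, a point determines the member of the
    family containing it; all later computations with \<open>E\<close> and \<open>K\<close> rest on
    this.\<close>
  have sep: "\<forall>\<^sub>\<infinity>p. \<forall>y\<in>{y \<in> Y. le y x}. \<forall>y'\<in>{y \<in> Y. le y x'}. p \<in> L y \<and> p \<in> L y' \<longrightarrow> y = y'"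
    if "x \<in> X" "x' \<in> X" for x x'
  proof (intro eventually_ball_finite sparse that ballI)
    fix y y' assume yy: "y \<in> {y \<in> Y. le y x}" "y' \<in> {y \<in> Y. le y x'}"
    show "\<forall>\<^sub>\<infinity>p. p \<in> L y \<and> p \<in> L y' \<longrightarrow> y = y'"
    proof (cases "y = y'")
      case False
      then have "\<forall>\<^sub>\<infinity>p. p \<notin> L y \<inter> L y'"
        unfolding eventually_cofinite_not_mem using ad yy Y(1) by auto
      then show ?thesis by eventually_elim auto
    qed simp
  qed
  have E_meet: "\<forall>\<^sub>\<infinity>p. p \<in> E x \<and> p \<in> E x' \<longleftrightarrow> p \<in> E (meet x x')"
    if x: "x \<in> X" "x' \<in> X" for x x'
    using sep[OF x]
  proof eventually_elim
    case (elim p)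
    show ?case
    proof
      assume "p \<in> E x \<and> p \<in> E x'"
      then obtain y y' where y: "y \<in> Y" "le y x" "p \<in> L y" "y' \<in> Y" "le y' x'" "p \<in> L y'"
        by (auto simp: E_def)
      then have "le y (meet x x')" using elim meet_greatest[OF x] Y(1) by blast
      then show "p \<in> E (meet x x')" using y by (auto simp: E_def)
    next
      assume "p \<in> E (meet x x')"
      then obtain y where y: "y \<in> Y" "le y (meet x x')" "p \<in> L y" by (auto simp: E_def)
      then have "le y x" "le y x'"
        using le_trans[of y "meet x x'"] meet_closed[OF x] meet_le1[OF x] meet_le2[OF x] x Y(1)
        by blast+
      then show "p \<in> E x \<and> p \<in> E x'" using y by (auto simp: E_def)
    qed
  qed
  have K_coh: "\<forall>\<^sub>\<infinity>p. p \<in> E y \<longrightarrow> (p \<in> K x \<longleftrightarrow> p \<in> K y)" if xy: "x \<in> X" "y \<in> X" "le y x" for x y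
    using sep[OF xy(1,2)]
  proof eventually_elim
    case (elim p)
    show ?case
    proof (intro impI iffI)
      assume "p \<in> E y" "p \<in> K x"
      then obtain z z' where z: "z \<in> Y" "le z y" "p \<in> L z" "z' \<in> Y" "le z' x" "p \<in> H z'"
        by (auto simp: E_def K_def)
      then have "p \<in> L z'" using H Y(1) by blast
      then have "z' = z" using elim z by blast
      then show "p \<in> K y" using z by (auto simp: K_def)
    next
      assume "p \<in> K y"
      then obtain z where z: "z \<in> Y" "le z y" "p \<in> H z" by (auto simp: K_def)
      then have "le z x" using le_trans[of z y x] xy Y(1) by blast
      then show "p \<in> K x" using z by (auto simp: K_def)
    qed
  qed
  \<comment> \<open>Even numbers carry the original representation, which preserves the private
    sets; odd numbers carry the unions of Luzin sets and the nontrivial system.\<close>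
  define B' where "B' x = {q. if even q then q div 2 \<in> B x else q div 2 \<in> E x}" for x
  define D' where "D' x = (\<lambda>p. 2 * p) ` D x" for x
  define G' where "G' x = {q. odd q \<and> q div 2 \<in> K x}" for x
  have "represents B' D'"
    unfolding represents_def
  proof (intro conjI ballI impI)
    fix x assume x: "x \<in> X"
    show "D' x \<subseteq> B' x" using representsD(1)[OF rep x] by (auto simp: B'_def D'_def)
    have "inj_on (\<lambda>p::nat. 2 * p) (D x)" by (auto intro: inj_onI)
    then show "infinite (D' x)"
      unfolding D'_def using representsD(2)[OF rep x] finite_imageD by blast
  next
    fix x y assume xy: "x \<in> X" "y \<in> X"
    show "\<forall>\<^sub>\<infinity>p. p \<in> B' x \<and> p \<in> B' y \<longleftrightarrow> p \<in> B' (meet x y)"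
      using eventually_cofinite_div2[OF representsD(3)[OF rep xy]]
        eventually_cofinite_div2[OF E_meet[OF xy]]
      by eventually_elim (auto simp: B'_def)
  next
    fix x z assume xz: "x \<in> X" "z \<in> X" "\<not> le x z"
    have "D' x \<inter> B' z \<subseteq> (\<lambda>p. 2 * p) ` (D x \<inter> B z)" by (auto simp: B'_def D'_def)
    then show "finite (D' x \<inter> B' z)"
      by (rule finite_subset) (use representsD(4)[OF rep xz] in simp)
  qed
  moreover have "coherent B' G'"
    unfolding coherent_def
  proof (intro conjI ballI impI)
    fix x assume "x \<in> X"
    show "G' x \<subseteq> B' x" using H Y(1) by (auto simp: G'_def B'_def K_def E_def)
  next
    fix x y assume xy: "x \<in> X" "y \<in> X" "le y x"
    show "\<forall>\<^sub>\<infinity>p. p \<in> B' y \<longrightarrow> (p \<in> G' x \<longleftrightarrow> p \<in> G' y)"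
      using eventually_cofinite_div2[OF K_coh[OF xy]]
      by eventually_elim (auto simp: B'_def G'_def)
  qed
  moreover have "\<not> trivial B' G'"
  proof
    assume "trivial B' G'"
    then obtain C where C: "\<And>x. x \<in> X \<Longrightarrow> \<forall>\<^sub>\<infinity>p. p \<in> B' x \<longrightarrow> (p \<in> C \<longleftrightarrow> p \<in> G' x)"
      by (auto simp: trivial_def)
    have "\<exists>n. \<forall>p\<ge>n. p \<in> L y \<longrightarrow> (2 * p + 1 \<in> C \<longleftrightarrow> p \<in> H y)" if y: "y \<in> Y" for y
    proof -
      have yX: "y \<in> X" using y Y(1) by blast
      have "inj (\<lambda>p::nat. 2 * p + 1)" by (auto intro: injI)
      from eventually_cofinite_inj[OF this C[OF yX]] sep[OF yX yX]
      have "\<forall>\<^sub>\<infinity>p. p \<in> L y \<longrightarrow> (2 * p + 1 \<in> C \<longleftrightarrow> p \<in> H y)"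
      proof eventually_elim
        case (elim p)
        show ?case
        proof
          assume p: "p \<in> L y"
          then have "p \<in> E y" using y le_refl[OF yX] by (auto simp: E_def)
          then have "2 * p + 1 \<in> C \<longleftrightarrow> p \<in> K y" using elim(1) by (simp add: B'_def G'_def)
          also have "\<dots> \<longleftrightarrow> p \<in> H y"
          proof
            assume "p \<in> K y"
            then obtain z where z: "z \<in> Y" "le z y" "p \<in> H z" by (auto simp: K_def)
            then have "p \<in> L z" using H Y(1) by blast
            then have "z = y" using elim(2) z p y le_refl[OF yX] by blast
            then show "p \<in> H y" using z by simp
          qed (use y le_refl[OF yX] in \<open>auto simp: K_def\<close>)
          finally show "2 * p + 1 \<in> C \<longleftrightarrow> p \<in> H y" .
        qed
      qed
      then show ?thesis by (rule eventually_cofinite_nat_bound)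
    qed
    \<comment> \<open>With a common threshold \<open>n\<close>, any two \<open>H y\<close> agree
      from \<open>n\<close> on along the intersection of their \<open>L y\<close>, both being traced
      out by \<open>C\<close>.\<close>
    from uncountable_pigeonhole[OF Y(2) this] obtain n
      where n: "uncountable {y \<in> Y. \<forall>p\<ge>n. p \<in> L y \<longrightarrow> (2 * p + 1 \<in> C \<longleftrightarrow> p \<in> H y)}" .
    let ?Z = "{y \<in> Y. \<forall>p\<ge>n. p \<in> L y \<longrightarrow> (2 * p + 1 \<in> C \<longleftrightarrow> p \<in> H y)}"
    have "?Z \<subseteq> X" using Y(1) by blast
    with n obtain y M where yM: "y \<in> ?Z" "M \<subseteq> ?Z" "infinite M" "\<forall>k\<in>M. (k, y) \<in> R"
      by (rule uncountable_R_bound)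
    have "M \<subseteq> {z. (z, y) \<in> R \<and> (\<forall>p\<in>L y \<inter> L z. n \<le> p \<longrightarrow> (p \<in> H y \<longleftrightarrow> p \<in> H z))}"
    proof (intro subsetI CollectI conjI ballI impI)
      fix z p assume z: "z \<in> M" and p: "p \<in> L y \<inter> L z" "n \<le> p"
      have "z \<in> ?Z" using z yM(2) by (rule subsetD[rotated])
      then show "p \<in> H y \<longleftrightarrow> p \<in> H z" using yM(1) p by auto
    qed (use yM(4) in auto)
    moreover have "y \<in> X" using yM(1) Y(1) by blast
    ultimately show False using luzin yM(3) by (meson finite_subset)
  qed
  ultimately show thesis by (rule that)
qed

text \<open>A trivialising set would agree with uncountably many \<open>G z\<close> from one
  threshold on. Density puts infinitely many of these \<open>z\<close> below a single
  \<open>x\<close>, and for all of them \<open>G z \<inter> B x - G x\<close> has a common bound,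
  against \<open>hausdorff_system\<close>.\<close>

lemma nontrivial_system_dense:
  assumes dense: "\<And>Z. Z \<subseteq> X \<Longrightarrow> uncountable Z \<Longrightarrow> \<exists>x\<in>X. infinite {z \<in> Z. le z x}"
  obtains B D G where "represents B D" "coherent B G" "\<not> trivial B G"
proof -
  obtain B D where rep: "represents B D" by (rule representation_exists)
  obtain G where coh: "coherent B G"
    and haus: "\<And>x n. x \<in> X \<Longrightarrow> finite {u \<in> below x. G u \<inter> B x - G x \<subseteq> {..<n}}"
    using hausdorff_system[OF rep] by blast
  have "\<not> trivial B G"
  proof
    assume "trivial B G"
    then obtain C where C: "\<And>x. x \<in> X \<Longrightarrow> \<forall>\<^sub>\<infinity>p. p \<in> B x \<longrightarrow> (p \<in> C \<longleftrightarrow> p \<in> G x)"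
      by (auto simp: trivial_def)
    have bound: "\<exists>n. \<forall>p\<ge>n. p \<in> B x \<longrightarrow> (p \<in> C \<longleftrightarrow> p \<in> G x)" if "x \<in> X" for x
      by (rule eventually_cofinite_nat_bound[OF C[OF that]])
    from uncountable_pigeonhole[OF uncountable_carrier this] obtain n
      where n: "uncountable {x \<in> X. \<forall>p\<ge>n. p \<in> B x \<longrightarrow> (p \<in> C \<longleftrightarrow> p \<in> G x)}" .
    let ?Z = "{x \<in> X. \<forall>p\<ge>n. p \<in> B x \<longrightarrow> (p \<in> C \<longleftrightarrow> p \<in> G x)}"
    obtain x where x: "x \<in> X" and inf: "infinite {z \<in> ?Z. le z x}"
      using dense[OF _ n] by blast
    \<comment> \<open>\<open>x\<close> may lie outside \<open>?Z\<close>, so it gets a threshold of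
      its own.\<close>
    obtain k where k: "\<forall>p\<ge>k. p \<in> B x \<longrightarrow> (p \<in> C \<longleftrightarrow> p \<in> G x)" using bound[OF x] by blast
    have "{z \<in> ?Z. le z x} \<subseteq> insert x {u \<in> below x. G u \<inter> B x - G x \<subseteq> {..<max n k}}"
    proof
      fix z assume z: "z \<in> {z \<in> ?Z. le z x}"
      have "G z \<subseteq> B z" using z coh by (simp add: coherent_def)
      then have "G z \<inter> B x - G x \<subseteq> {..<max n k}"
      proof -
        have "p < max n k" if p: "p \<in> G z" "p \<in> B x" "p \<notin> G x" for p
        proof (rule ccontr)
          assume "\<not> p < max n k"
          then have "n \<le> p" "k \<le> p" by auto
          then have "p \<in> C" "p \<notin> C" using p z k \<open>G z \<subseteq> B z\<close> by auto
          then show False by contradiction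
        qed
        then show ?thesis by auto
      qed
      then show "z \<in> insert x {u \<in> below x. G u \<inter> B x - G x \<subseteq> {..<max n k}}"
        using z by (auto simp: below_def)
    qed
    moreover have "finite (insert x {u \<in> below x. G u \<inter> B x - G x \<subseteq> {..<max n k}})"
      using haus[OF x] by simp
    ultimately show False using inf finite_subset by blast
  qed
  with rep coh show thesis by (rule that)
qed

lemma nontrivial_system_exists:
  obtains B D G where "represents B D" "coherent B G" "\<not> trivial B G"
proof (cases "\<exists>Y\<subseteq>X. uncountable Y \<and> (\<forall>x\<in>X. finite {y \<in> Y. le y x})")
  case True
  then obtain Y where "Y \<subseteq> X" "uncountable Y" "\<And>x. x \<in> X \<Longrightarrow> finite {y \<in> Y. le y x}" by blast
  from nontrivial_system_sparse[OF this] show ?thesis using that by metis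
next
  case False
  have "\<exists>x\<in>X. infinite {z \<in> Z. le z x}" if "Z \<subseteq> X" "uncountable Z" for Z
  proof (rule ccontr)
    assume "\<not> ?thesis"
    with that have "Z \<subseteq> X \<and> uncountable Z \<and> (\<forall>x\<in>X. finite {z \<in> Z. le z x})" by simp
    then have "\<exists>Y\<subseteq>X. uncountable Y \<and> (\<forall>x\<in>X. finite {y \<in> Y. le y x})" by (rule exI)
    with False show False by (rule notE)
  qed
  from nontrivial_system_dense[OF this] show ?thesis using that by metis
qed

section \<open>Counting classes\<close>

lemma represents_pullback:
  assumes rep: "represents B D"
  shows "represents (\<lambda>x. pullback (B x)) (\<lambda>x. pullback (D x))"
  unfolding represents_def
proof (intro conjI ballI impI)
  fix x assume x: "x \<in> X"
  show "pullback (D x) \<subseteq> pullback (B x)"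
    using representsD(1)[OF rep x] by (auto simp: pullback_def)
  show "infinite (pullback (D x))"
    using representsD(2)[OF rep x] by (rule infinite_pullback)
next
  fix x y assume xy: "x \<in> X" "y \<in> X"
  show "\<forall>\<^sub>\<infinity>p. p \<in> pullback (B x) \<and> p \<in> pullback (B y) \<longleftrightarrow> p \<in> pullback (B (meet x y))"
    using eventually_cofinite_pullback[OF representsD(3)[OF rep xy]]
    by eventually_elim (auto simp: pullback_def)
next
  fix x z assume xz: "x \<in> X" "z \<in> X" "\<not> le x z"
  have "\<forall>\<^sub>\<infinity>p. p \<notin> D x \<inter> B z"
    unfolding eventually_cofinite_not_mem by (rule representsD(4)[OF rep xz])
  from eventually_cofinite_pullback[OF this]
  have "\<forall>\<^sub>\<infinity>p. p \<notin> pullback (D x) \<inter> pullback (B z)"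
    by eventually_elim (auto simp: pullback_def)
  then show "finite (pullback (D x) \<inter> pullback (B z))"
    by (simp only: eventually_cofinite_not_mem)
qed

definition slices :: "('a \<Rightarrow> nat set) \<Rightarrow> nat set \<Rightarrow> 'a \<Rightarrow> nat set" where
  "slices G \<psi> x = {q \<in> pullback (G x). fst (prod_decode q) \<in> \<psi>}"

lemma coherent_slices:
  assumes "coherent B G"
  shows "coherent (\<lambda>x. pullback (B x)) (slices G \<psi>)"
  unfolding coherent_def
proof (intro conjI ballI impI)
  fix x assume "x \<in> X"
  then show "slices G \<psi> x \<subseteq> pullback (B x)"
    using assms by (auto simp: coherent_def slices_def pullback_def)
next
  fix x y assume "x \<in> X" "y \<in> X" "le y x"
  then have "\<forall>\<^sub>\<infinity>p. p \<in> B y \<longrightarrow> (p \<in> G x \<longleftrightarrow> p \<in> G y)" using assms by (simp add: coherent_def)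
  from eventually_cofinite_pullback[OF this]
  show "\<forall>\<^sub>\<infinity>p. p \<in> pullback (B y) \<longrightarrow> (p \<in> slices G \<psi> x \<longleftrightarrow> p \<in> slices G \<psi> y)"
    by eventually_elim (auto simp: slices_def pullback_def)
qed

text \<open>In a row \<open>n\<close> that belongs to exactly one of the two index sets, the
  difference is a copy of \<open>G\<close> from \<open>k = n\<close> on. Row \<open>n\<close> of a
  trivialising set would therefore trivialise \<open>G\<close>.\<close>

lemma nontrivial_slices:
  assumes nontriv: "\<not> trivial B G" and neq: "\<psi> \<noteq> \<psi>'"
  shows "\<not> trivial (\<lambda>x. pullback (B x)) (\<lambda>x. sym_diff (slices G \<psi> x) (slices G \<psi>' x))"
proof
  assume "trivial (\<lambda>x. pullback (B x)) (\<lambda>x. sym_diff (slices G \<psi> x) (slices G \<psi>' x))"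
  then obtain C where C: "\<And>x. x \<in> X \<Longrightarrow> \<forall>\<^sub>\<infinity>p. p \<in> pullback (B x) \<longrightarrow>
      (p \<in> C \<longleftrightarrow> p \<in> sym_diff (slices G \<psi> x) (slices G \<psi>' x))"
    by (auto simp: trivial_def)
  obtain n where n: "n \<in> \<psi> \<longleftrightarrow> n \<notin> \<psi>'" using neq by blast
  have "\<forall>\<^sub>\<infinity>k. k \<in> B x \<longrightarrow> (k \<in> {k. prod_encode (n, k) \<in> C} \<longleftrightarrow> k \<in> G x)" if x: "x \<in> X" for x
  proof -
    have "inj (\<lambda>k. prod_encode (n, k))" by (auto intro: injI)
    note eventually_cofinite_inj[OF this C[OF x]]
    moreover have "\<forall>\<^sub>\<infinity>k. n \<le> k" by (simp add: eventually_cofinite not_le)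
    ultimately show ?thesis
      by eventually_elim (use n in \<open>auto simp: mem_sym_diff slices_def pullback_def\<close>)
  qed
  then have "trivial B G" unfolding trivial_def by blast
  with nontriv show False by contradiction
qed

section \<open>From systems on \<open>X\<close> to subsystems of the family of sets\<close>

text \<open>The index of \<open>A\<close> is recovered by \<open>inv_into\<close>, uniquely since a
  representation is injective. The value \<open>{}\<close> elsewhere matches the normalisation in
  \<open>coherent_subsystems\<close>.\<close>

definition lift :: "('a \<Rightarrow> nat set) \<Rightarrow> ('a \<Rightarrow> nat set) \<Rightarrow> nat set \<Rightarrow> nat set" where
  "lift B G A = (if A \<in> B ` X then G (inv_into X B A) else {})"

lemma represents_inj_on:
  assumes "represents B D"
  shows "inj_on B X"
proof (rule inj_onI)
  fix x y assume xy: "x \<in> X" "y \<in> X" "B x = B y"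
  then have "le x y" "le y x"
    using represents_le_iff[OF assms] by (simp_all add: subset_star_def)
  then show "x = y" using xy le_antisym by blast
qed

lemma lift_apply: "represents B D \<Longrightarrow> x \<in> X \<Longrightarrow> lift B G (B x) = G x"
  by (simp add: lift_def represents_inj_on)

lemma lift_coherent:
  assumes rep: "represents B D" and coh: "coherent B G"
  shows "lift B G \<in> coherent_subsystems (B ` X)"
  unfolding coherent_subsystems_def mem_Collect_eq
proof (intro conjI allI ballI impI)
  fix A A' assume "A \<in> B ` X" "A' \<in> B ` X" "subset_star A' A"
  then obtain x y where xy: "x \<in> X" "y \<in> X" "A = B x" "A' = B y" "le y x"
    using represents_le_iff[OF rep] by blast
  have "\<forall>\<^sub>\<infinity>p. p \<in> B y \<longrightarrow> (p \<in> G x \<longleftrightarrow> p \<in> G y)" and "G y \<subseteq> B y"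
    using coh xy by (auto simp: coherent_def)
  then show "eq_star (lift B G A \<inter> A') (lift B G A')"
    unfolding xy(3,4) lift_apply[OF rep xy(1)] lift_apply[OF rep xy(2)] eq_star_iff
    by (auto elim!: eventually_mono)
next
  fix A assume "A \<in> B ` X"
  then obtain x where "x \<in> X" "A = B x" by blast
  then show "lift B G A \<subseteq> A" using coh lift_apply[OF rep] by (simp add: coherent_def)
qed (simp add: lift_def)

text \<open>Both values at \<open>x\<close> are contained in \<open>B x\<close>, so outside
  \<open>B x\<close> the two pointwise conditions hold trivially, and inside they coincide.\<close>

lemma cohomologous_lift_iff:
  assumes rep: "represents B D" and coh: "coherent B G" "coherent B H"
  shows "(lift B G, lift B H) \<in> cohomologous (B ` X) \<longleftrightarrow>
    trivial B (\<lambda>x. sym_diff (G x) (H x))"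
proof -
  have "(\<forall>\<^sub>\<infinity>p. p \<in> C \<inter> B x \<longleftrightarrow> (p \<in> lift B G (B x) \<longleftrightarrow> p \<notin> lift B H (B x))) \<longleftrightarrow>
      (\<forall>\<^sub>\<infinity>p. p \<in> B x \<longrightarrow> (p \<in> C \<longleftrightarrow> p \<in> sym_diff (G x) (H x)))" if x: "x \<in> X" for x C
  proof (rule eventually_cong[OF always_eventually], rule allI)
    fix p
    have "G x \<subseteq> B x" "H x \<subseteq> B x" using coh x by (auto simp: coherent_def)
    then show "(p \<in> C \<inter> B x \<longleftrightarrow> (p \<in> lift B G (B x) \<longleftrightarrow> p \<notin> lift B H (B x))) \<longleftrightarrow>
      (p \<in> B x \<longrightarrow> (p \<in> C \<longleftrightarrow> p \<in> sym_diff (G x) (H x)))"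
      unfolding lift_apply[OF rep x] mem_sym_diff by blast
  qed
  then show ?thesis
    by (simp add: cohomologous_iff lift_coherent[OF rep] coh trivial_def)
qed

section \<open>The cardinality of the gap cohomology group\<close>

text \<open>For the lower bound, each subset \<open>S\<close> of \<open>X\<close> is coded by the
  class of a system \<open>G S\<close> together with a set \<open>C S\<close> of natural numbers.
  The family \<open>K\<close> provides continuum many classes, so the second factor is absorbed. The
  upper bound counts all coherent subsystems.\<close>

lemma card_of_gap_cohomology:
  assumes rep: "represents B D"
    and K: "\<And>\<psi> :: nat set. coherent B (K \<psi>)"
      "\<And>\<psi> \<psi>'. \<psi> \<noteq> \<psi>' \<Longrightarrow> \<not> trivial B (\<lambda>x. sym_diff (K \<psi> x) (K \<psi>' x))"
  shows "|gap_cohomology (B ` X)| =o |Pow X|"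
proof -
  let ?T = "B ` X"
  define cls where "cls G = cohomologous ?T `` {lift B G}" for G
  have cls_mem: "cls G \<in> gap_cohomology ?T" if "coherent B G" for G
    unfolding cls_def gap_cohomology_quotient
    by (rule quotientI[OF lift_coherent[OF rep that]])
  have cls_eq: "cls G = cls H \<longleftrightarrow> trivial B (\<lambda>x. sym_diff (G x) (H x))"
    if "coherent B G" "coherent B H" for G H
    unfolding cls_def cohomologous_lift_iff[OF rep that, symmetric]
    by (rule eq_equiv_class_iff[OF equiv_cohomologous lift_coherent[OF rep that(1)]
          lift_coherent[OF rep that(2)]])
  have continuum: "|UNIV :: nat set set| \<le>o |gap_cohomology ?T|"
  proof (rule card_of_ordLeqI)
    show "inj_on (\<lambda>\<psi>. cls (K \<psi>)) UNIV"
      using K(2) cls_eq[OF K(1) K(1)] by (meson inj_onI)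
    show "cls (K \<psi>) \<in> gap_cohomology ?T" for \<psi> by (rule cls_mem[OF K(1)])
  qed
  have inf: "infinite (gap_cohomology ?T)"
  proof
    assume "finite (gap_cohomology ?T)"
    then have "finite (UNIV :: nat set set)" using continuum card_of_ordLeq_finite by blast
    then show False by (simp add: Finite_Set.finite_set)
  qed
  have "\<exists>G. coherent B G \<and> (\<forall>x\<in>X. (x \<in> S \<longrightarrow> D x \<subseteq> G x) \<and> (x \<notin> S \<longrightarrow> D x \<inter> G x = {}))" for S
    by (rule coherent_with_prescribed_pattern[OF rep, of S]) blast
  then have "\<forall>S. \<exists>G. coherent B G \<and>
      (\<forall>x\<in>X. (x \<in> S \<longrightarrow> D x \<subseteq> G x) \<and> (x \<notin> S \<longrightarrow> D x \<inter> G x = {}))" ..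
  from choice[OF this] obtain G where "\<forall>S. coherent B (G S) \<and>
      (\<forall>x\<in>X. (x \<in> S \<longrightarrow> D x \<subseteq> G S x) \<and> (x \<notin> S \<longrightarrow> D x \<inter> G S x = {}))" ..
  then have G: "\<And>S. coherent B (G S)"
    "\<And>S x. x \<in> X \<Longrightarrow> x \<in> S \<Longrightarrow> D x \<subseteq> G S x" "\<And>S x. x \<in> X \<Longrightarrow> x \<notin> S \<Longrightarrow> D x \<inter> G S x = {}"
    by simp_all
  \<comment> \<open>One reference system is fixed in each class; \<open>C S\<close> trivialises the
    difference of \<open>G S\<close> from the reference of its class, so class and
    \<open>C S\<close> together determine \<open>G S\<close> modulo finite.\<close>
  define base where "base c = (SOME S. cls (G S) = c)" for c
  define C where "C S = (SOME C. \<forall>x\<in>X. \<forall>\<^sub>\<infinity>p. p \<in> B x \<longrightarrow>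
    (p \<in> C \<longleftrightarrow> p \<in> sym_diff (G S x) (G (base (cls (G S))) x)))" for S
  have C: "\<forall>\<^sub>\<infinity>p. p \<in> B x \<longrightarrow> (p \<in> C S \<longleftrightarrow> p \<in> sym_diff (G S x) (G (base (cls (G S))) x))"
    if "x \<in> X" for S x
  proof -
    have "cls (G (base (cls (G S)))) = cls (G S)" unfolding base_def by (rule someI) simp
    then have "trivial B (\<lambda>x. sym_diff (G S x) (G (base (cls (G S))) x))"
      using cls_eq[OF G(1) G(1)] by metis
    then have "\<exists>C. \<forall>x\<in>X. \<forall>\<^sub>\<infinity>p. p \<in> B x \<longrightarrow>
        (p \<in> C \<longleftrightarrow> p \<in> sym_diff (G S x) (G (base (cls (G S))) x))" by (simp add: trivial_def)
    from someI_ex[OF this] show ?thesis using that unfolding C_def by blast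
  qed
  have "inj_on (\<lambda>S. (cls (G S), C S)) (Pow X)"
  proof (rule inj_onI)
    fix S S' assume S: "S \<in> Pow X" "S' \<in> Pow X" "(cls (G S), C S) = (cls (G S'), C S')"
    have iff: "x \<in> S \<longleftrightarrow> x \<in> S'" if x: "x \<in> X" for x
    proof (rule ccontr)
      \<comment> \<open>Equal codes make \<open>G S x\<close> and \<open>G S' x\<close> almost equal
        on \<open>B x\<close>, yet on \<open>D x\<close> one of them is everything and the other is
        empty, which would make \<open>D x\<close> finite.\<close>
      assume neq: "\<not> (x \<in> S \<longleftrightarrow> x \<in> S')"
      have "\<forall>\<^sub>\<infinity>p. p \<in> B x \<longrightarrow> (p \<in> G S x \<longleftrightarrow> p \<in> G S' x)"
        using C[OF x, of S] C[OF x, of S']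
      proof eventually_elim
        case (elim p)
        then show ?case using S(3) by (auto simp: mem_sym_diff)
      qed
      then have "\<forall>\<^sub>\<infinity>p. p \<notin> D x"
        by eventually_elim
          (use neq G(2,3)[OF x, of S] G(2,3)[OF x, of S'] representsD(1)[OF rep x] in blast)
      then show False
        using representsD(2)[OF rep x] by (simp only: eventually_cofinite_not_mem)
    qed
    then show "S = S'" using S(1,2) by blast
  qed
  then have "|Pow X| \<le>o |gap_cohomology ?T \<times> (UNIV :: nat set set)|"
    by (rule card_of_ordLeqI) (use cls_mem G(1) in auto)
  also have "|gap_cohomology ?T \<times> (UNIV :: nat set set)| =o |gap_cohomology ?T|"
    using card_of_Times_infinite_simps(1)[OF inf _ continuum] by blast
  finally have lower: "|Pow X| \<le>o |gap_cohomology ?T|" .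
  have bij: "bij_betw B X ?T" using represents_inj_on[OF rep] by (simp add: bij_betw_def)
  have infX: "infinite X" using uncountable_carrier countable_finite by blast
  have "gap_cohomology ?T = (\<lambda>f. cohomologous ?T `` {f}) ` coherent_subsystems ?T"
    by (auto simp: gap_cohomology_quotient quotient_def)
  then have "|gap_cohomology ?T| \<le>o |coherent_subsystems ?T|" by (simp add: card_of_image)
  also have "|coherent_subsystems ?T| \<le>o |Pow ?T|"
    using card_of_coherent_subsystems_le bij infX bij_betw_finite by blast
  also have "|Pow ?T| =o |Pow X|"
    using card_of_ordIsoI[OF bij_betw_Pow[OF bij]] ordIso_symmetric by blast
  finally show ?thesis using lower ordIso_iff_ordLeq by blast
qed

end

theorem mainTheorem7:
  fixes X :: "'a set" and le :: "'a \<Rightarrow> 'a \<Rightarrow> bool"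
  assumes "lower_semi_lattice X le"
    and "omega1_like X le"
  shows "\<exists>T :: nat set set. star_lower_semi_lattice T \<and>
           (\<exists>h. bij_betw h X T \<and>
                (\<forall>x\<in>X. \<forall>y\<in>X. le x y \<longleftrightarrow> subset_star (h x) (h y))) \<and>
           (card_of (gap_cohomology T), card_of (Pow X)) \<in> ordIso"
proof -
  have po: "partial_order_on_set X le" and "\<forall>x\<in>X. \<forall>y\<in>X. \<exists>z. is_inf X le x y z"
    using assms(1) by (auto simp: lower_semi_lattice_def)
  then obtain meet where meet: "\<And>x y. x \<in> X \<Longrightarrow> y \<in> X \<Longrightarrow> is_inf X le x y (meet x y)"
    by metis
  have wf: "wf {(a, b). a \<in> X \<and> b \<in> X \<and> le a b \<and> a \<noteq> b}"
    and card: "|X| =o cardSuc natLeq"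
    and count: "\<And>x. x \<in> X \<Longrightarrow> countable {y \<in> X. le y x \<and> y \<noteq> x}"
    using assms(2) by (auto simp: omega1_like_def wfp_def)
  obtain R where R: "wf R" "R \<subseteq> X \<times> X"
    "\<forall>x\<in>X. \<forall>y\<in>X. x \<noteq> y \<longrightarrow> (x, y) \<in> R \<or> (y, x) \<in> R"
    "\<forall>x. countable {y. (y, x) \<in> R}"
    "\<forall>x\<in>X. \<forall>y\<in>X. le x y \<and> x \<noteq> y \<longrightarrow> (x, y) \<in> R"
    by (rule omega1_linear_extension[OF wf card count])
  interpret omega1_semilattice X le meet R
  proof
    fix x y z assume xy: "x \<in> X" "y \<in> X"
    show "le x x" using po xy(1) by (simp add: partial_order_on_set_def)
    show "x = y" if "le x y" "le y x" using po xy that unfolding partial_order_on_set_def by blast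
    show "meet x y \<in> X" "le (meet x y) x" "le (meet x y) y"
      using meet[OF xy] by (simp_all add: is_inf_def)
    assume z: "z \<in> X"
    show "le x z" if "le x y" "le y z"
      using po xy z that unfolding partial_order_on_set_def by blast
    show "le z (meet x y)" if "le z x" "le z y" using meet[OF xy] z that by (simp add: is_inf_def)
  next
    show "uncountable X" by (rule uncountable_of_card_of_cardSuc[OF card])
  qed (use R in simp_all)
  obtain B D G where BDG: "represents B D" "coherent B G" "\<not> trivial B G"
    by (rule nontrivial_system_exists)
  \<comment> \<open>The final family is the pulled back one, since the continuum many inequivalent
    systems \<open>slices G\<close> live there.\<close>
  define h where "h x = pullback (B x)" for x
  have rep: "represents h (\<lambda>x. pullback (D x))"
    unfolding h_def by (rule represents_pullback[OF BDG(1)])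
  have "star_lower_semi_lattice (h ` X)"
    unfolding star_lower_semi_lattice_def eq_star_iff
  proof safe
    fix x y assume xy: "x \<in> X" "y \<in> X"
    then show "\<exists>C\<in>h ` X. \<forall>\<^sub>\<infinity>p. p \<in> h x \<inter> h y \<longleftrightarrow> p \<in> C"
      using representsD(3)[OF rep xy] meet_closed[OF xy]
      by (intro bexI[of _ "h (meet x y)"]) simp_all
  qed
  moreover have "bij_betw h X (h ` X)"
    using represents_inj_on[OF rep] by (simp add: bij_betw_def)
  moreover have "|gap_cohomology (h ` X)| =o |Pow X|"
    using card_of_gap_cohomology[OF rep, of "slices G"]
      coherent_slices[OF BDG(2), folded h_def] nontrivial_slices[OF BDG(3), folded h_def]
    by simp
  moreover have "\<forall>x\<in>X. \<forall>y\<in>X. le x y \<longleftrightarrow> subset_star (h x) (h y)"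
    using represents_le_iff[OF rep] by simp
  ultimately show ?thesis by (intro exI[of _ "h ` X"] exI[of _ h] conjI)
qed

end
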